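(* Let $(\phi_t)$ and $(\tilde\phi_t)$ be non-elliptic semigroups in $\mathbb D$ with Koenigs functions $h$ and $\tilde h$, orthogonal speeds $v^o(t)$ and $\tilde v^o(t)$, respectively, and let $\tilde v(t)$ be the total speed of $(\tilde\phi_t)$. Suppose that $h(\mathbb D)\subset\tilde h(\mathbb D)$ and that at least one of the following holds: (1) $\phi_t(0)$ converges non-tangentially, as $t\to+\infty$, to the Denjoy-Wolff point of $(\phi_t)$; (2) $\tilde\phi_t(0)$ converges non-tangentially, as $t\to+\infty$, to the Denjoy-Wolff point of $(\tilde\phi_t)$; (3) $[0,+\infty)\ni t\mapsto\tilde v^o(t)$ is (eventually) non-decreasing; (4) $[0,+\infty)\ni t\mapsto\tilde v(t)$ is (eventually) non-decreasing. Then $$\liminf_{t\to+\infty}\,[v^o(t)-\tilde v^o(t)]>-\infty.$$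
   Context: Let $\mathbb D=\{z\in\mathbb C:|z|<1\}$. A (continuous) semigroup in $\mathbb D$ is a family $(\phi_t)_{t\ge0}$ of holomorphic self-maps of $\mathbb D$ with $\phi_0=\mathrm{id}$, $\phi_{s+t}=\phi_s\circ\phi_t$, and $t\mapsto\phi_t$ continuous for uniform convergence on compacta. It is non-elliptic if it has no fixed points in $\mathbb D$ (no $z\in\mathbb D$ with $\phi_t(z)=z$ for all $t\geq 0$). In that case there is a unique $\tau\in\partial\mathbb D$, the Denjoy-Wolff point, with $\lim_{t\to+\infty}\phi_t(z)=\tau$ for all $z\in\mathbb D$. A Koenigs function of a non-elliptic semigroup $(\phi_t)$ is a univalent function $h:\mathbb D\to\mathbb C$ such that (i) $h(\phi_t(z))=h(z)+it$ for all $z\in\mathbb D$, $t\ge0$, and (ii) $\bigcup_{t\ge0}(h(\mathbb D)-it)$ is a vertical strip, a vertical half-plane, or $\mathbb C$; it exists and is essentially unique (up to an additive constant). Let $k_{\mathbb D}$ be the hyperbolic distance of $\mathbb D$, normalized by $k_{\mathbb D}(0,z)=\frac12\log\frac{1+|z|}{1-|z|}$. For $z\in\mathbb D$ let $\pi(z)$ be the unique point of the geodesic $(-1,1)\tau$ that is closest to $z$ with respect to $k_{\mathbb D}$. The total speed of $(\phi_t)$ is $v(t):=k_{\mathbb D}(0,\phi_t(0))$ and the orthogonal speed is $v^o(t):=k_{\mathbb D}(0,\pi(\phi_t(0)))$, $t\ge0$. Non-tangential convergence of $\phi_t(0)$ to $\tau$ means $\phi_t(0)\to\tau$ and $|\tau-\phi_t(0)|\le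 M(1-|\phi_t(0)|)$ for some constant $M$ and all large $t$. Eventually non-decreasing means non-decreasing on $[t_0,+\infty)$ for some $t_0\ge0$. *)

theory Defs
  imports "HOL-Complex_Analysis.Complex_Analysis"
begin

abbreviation unit_disc :: "complex set" where
  "unit_disc \<equiv> ball 0 1"

text \<open>A family of self-maps is a curried function, of which only the values for
  \<open>t \<ge> 0\<close> and \<open>z\<close> in the disc are relevant.\<close>

definition disc_semigroup :: "(real \<Rightarrow> complex \<Rightarrow> complex) \<Rightarrow> bool" where
  "disc_semigroup \<phi> \<longleftrightarrow>
     (\<forall>t\<ge>0. \<phi> t holomorphic_on unit_disc \<and> \<phi> t ` unit_disc \<subseteq> unit_disc) \<and>
     (\<forall>z\<in>unit_disc. \<phi> 0 z = z) \<and>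
     (\<forall>s\<ge>0. \<forall>t\<ge>0. \<forall>z\<in>unit_disc. \<phi> (s + t) z = \<phi> s (\<phi> t z)) \<and>
     (\<forall>t\<ge>0. \<forall>K. compact K \<and> K \<subseteq> unit_disc \<longrightarrow> uniform_limit K \<phi> (\<phi> t) (at t within {0..}))"

definition non_elliptic :: "(real \<Rightarrow> complex \<Rightarrow> complex) \<Rightarrow> bool" where
  "non_elliptic \<phi> \<longleftrightarrow> \<not> (\<exists>z\<in>unit_disc. \<forall>t\<ge>0. \<phi> t z = z)"

definition denjoy_wolff_point :: "(real \<Rightarrow> complex \<Rightarrow> complex) \<Rightarrow> complex" where
  "denjoy_wolff_point \<phi> =
     (THE \<tau>. \<tau> \<in> sphere 0 1 \<and> (\<forall>z\<in>unit_disc. ((\<lambda>t. \<phi> t z) \<longlongrightarrow> \<tau>) at_top))"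

definition vertical_strip :: "complex set \<Rightarrow> bool" where
  "vertical_strip S \<longleftrightarrow> (\<exists>a b. a < b \<and> S = {w. a < Re w \<and> Re w < b})"

definition vertical_half_plane :: "complex set \<Rightarrow> bool" where
  "vertical_half_plane S \<longleftrightarrow> (\<exists>a. S = {w. a < Re w} \<or> S = {w. Re w < a})"

definition koenigs_function ::
    "(real \<Rightarrow> complex \<Rightarrow> complex) \<Rightarrow> (complex \<Rightarrow> complex) \<Rightarrow> bool" where
  "koenigs_function \<phi> h \<longleftrightarrow>
     h holomorphic_on unit_disc \<and> inj_on h unit_disc \<and>
     (\<forall>z\<in>unit_disc. \<forall>t\<ge>0. h (\<phi> t z) = h z + \<i> * of_real t) \<and>
     (let U = (\<Union>t\<in>{0..}. (\<lambda>w. w - \<i> * of_real t) ` h ` unit_disc)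
      in vertical_strip U \<or> vertical_half_plane U \<or> U = UNIV)"

text \<open>The hyperbolic distance in terms of the pseudo-hyperbolic distance;
  \<open>artanh x = ln ((1 + x) / (1 - x)) / 2\<close>.\<close>

definition hyp_dist :: "complex \<Rightarrow> complex \<Rightarrow> real" where
  "hyp_dist z w = artanh (cmod ((z - w) / (1 - cnj w * z)))"

lemma hyp_dist_0: "hyp_dist 0 z = 1 / 2 * ln ((1 + cmod z) / (1 - cmod z))"
  by (simp add: hyp_dist_def artanh_def)

definition diameter_geodesic :: "complex \<Rightarrow> complex set" where
  "diameter_geodesic \<tau> = (\<lambda>r. of_real r * \<tau>) ` {-1<..<1}"

definition hyp_proj :: "complex \<Rightarrow> complex \<Rightarrow> complex" where
  "hyp_proj \<tau> z =
     (THE p. p \<in> diameter_geodesic \<tau> \<and>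
             (\<forall>q\<in>diameter_geodesic \<tau>. hyp_dist z p \<le> hyp_dist z q))"

definition total_speed :: "(real \<Rightarrow> complex \<Rightarrow> complex) \<Rightarrow> real \<Rightarrow> real" where
  "total_speed \<phi> t = hyp_dist 0 (\<phi> t 0)"

definition orthogonal_speed :: "(real \<Rightarrow> complex \<Rightarrow> complex) \<Rightarrow> real \<Rightarrow> real" where
  "orthogonal_speed \<phi> t = hyp_dist 0 (hyp_proj (denjoy_wolff_point \<phi>) (\<phi> t 0))"

definition nontangential_orbit :: "(real \<Rightarrow> complex \<Rightarrow> complex) \<Rightarrow> bool" where
  "nontangential_orbit \<phi> \<longleftrightarrow>
     (let \<tau> = denjoy_wolff_point \<phi>
      in ((\<lambda>t. \<phi> t 0) \<longlongrightarrow> \<tau>) at_top \<and>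
         (\<exists>M. \<forall>\<^sub>F t in at_top. cmod (\<tau> - \<phi> t 0) \<le> M * (1 - cmod (\<phi> t 0))))"

definition eventually_nondecreasing :: "(real \<Rightarrow> real) \<Rightarrow> bool" where
  "eventually_nondecreasing v \<longleftrightarrow> (\<exists>t\<^sub>0\<ge>0. mono_on {t\<^sub>0..} v)"

end

theory Submission
  imports Defs
begin

text \<open>
  Let \<open>\<tau>\<close> be the Denjoy--Wolff point of a semigroup. The Cayley transform
  \<open>w = (\<tau> + z) / (\<tau> - z)\<close> moves the disc to the right half-plane and \<open>\<tau>\<close> to infinity, and the
  geodesic through \<open>0\<close> and \<open>\<tau>\<close> to the positive axis. The point of that axis closest to \<open>w\<close> is
  \<open>\<bar>w\<bar>\<close>, so the orthogonal speed of an orbit \<open>w\<^sub>t\<close> is \<open>\<bar>ln \<bar>w\<^sub>t\<bar>\<bar> / 2\<close>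
  (\<open>orthogonal_speed_eq\<close>). Since \<open>\<bar>w\<^sub>t\<bar> \<rightarrow> \<infinity>\<close>, the assertion says that the orbits \<open>w\<^sub>t\<close> of \<open>\<phi>\<close> and
  \<open>v\<^sub>t\<close> of \<open>\<psi>\<close> satisfy \<open>\<bar>v\<^sub>t\<bar> \<le> K \<bar>w\<^sub>t\<bar>\<close> for large \<open>t\<close> (\<open>orbit_comparison\<close>).

  The inclusion of the Koenigs domains makes \<open>f = g\<inverse> \<circ> h\<close> a univalent self-map of the disc with
  \<open>f \<circ> \<phi>\<^sub>t = \<psi>\<^sub>t \<circ> f\<close> (\<open>koenigs_transfer\<close>). Read in the half-planes it is a univalent \<open>F\<close>, and by
  the Schwarz--Pick lemma \<open>F(w\<^sub>t)\<close> stays within bounded hyperbolic distance of \<open>v\<^sub>t\<close>, so that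
  \<open>\<bar>F(w\<^sub>t)\<bar>\<close> and \<open>\<bar>v\<^sub>t\<bar>\<close> are comparable. The Schwarz--Pick lemma also bounds \<open>\<bar>F(w)\<bar>\<close> by a multiple
  of \<open>\<bar>w + 1\<bar>\<^sup>2 / Re w\<close> (\<open>cayley_growth\<close>). If \<open>\<phi>\<^sub>t(0)\<close> converges non-tangentially, then \<open>Re w\<^sub>t\<close>
  is comparable to \<open>\<bar>w\<^sub>t\<bar>\<close> and this bound is already the claim.

  In the other three cases \<open>\<bar>v\<^sub>s\<bar> \<ge> c \<bar>v\<^sub>t\<bar>\<close> for all \<open>s \<ge> t\<close>
  (\<open>orbit_cayley_almost_nondecreasing\<close>). For a non-decreasing orthogonal speed this is immediate;
  in the other two cases it follows because \<open>Re v\<^sub>t\<close> is non-decreasing, that is, because horodiscs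
  at the Denjoy--Wolff point are invariant. Hence on the
  whole curve \<open>w\<^sub>s\<close>, \<open>s \<ge> t\<close>, which runs from the circle of radius \<open>\<bar>w\<^sub>t\<bar>\<close> to infinity, \<open>\<bar>F\<bar>\<close> is at
  least some \<open>R\<close> comparable to \<open>\<bar>v\<^sub>t\<bar>\<close>, whereas \<open>\<bar>F(x)\<bar> \<le> C x\<close> on the positive axis. A
  length-area argument forces \<open>R \<le> K \<bar>w\<^sub>t\<bar>\<close> (\<open>escaping_curve_bound\<close>): each half-circle of radius
  between \<open>\<bar>w\<^sub>t\<bar>\<close> and \<open>R / (3 C)\<close> joins a point of the curve to a point of the axis, so the
  univalent function \<open>R / (F + R)\<close>, which maps into the unit disc, oscillates by at least
  \<open>1 / 6\<close> on it. As the area of the image is at most that of the disc, the logarithmic width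
  \<open>ln (R / (3 C \<bar>w\<^sub>t\<bar>))\<close> of this annulus is bounded.

  The formula for the speed presupposes that the Denjoy--Wolff point exists; this is proved in
  \<open>denjoy_wolff\<close> by Wolff's lemma, the Koenigs function excluding interior accumulation points of
  orbits.
\<close>

section \<open>The Schwarz--Pick lemma and the half-plane coordinate\<close>

text \<open>The pseudo-hyperbolic distance: the hyperbolic distance is an increasing function of it, and
  every comparison of distances below is made at this level.\<close>

definition pdist :: "complex \<Rightarrow> complex \<Rightarrow> real" where
  "pdist z w = cmod (Moebius_function 0 w z)"

lemma hyp_dist_eq_artanh_pdist: "hyp_dist z w = artanh (pdist z w)"
  by (simp add: hyp_dist_def pdist_def Moebius_function_simple)

lemma one_minus_cnj_mult_nonzero:
  assumes "cmod z < 1" "cmod w \<le> 1"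
  shows "1 - cnj w * z \<noteq> 0"
proof
  assume "1 - cnj w * z = 0"
  then have "cmod w * cmod z = 1"
    by (metis complex_mod_cnj norm_mult norm_one right_minus_eq)
  moreover have "cmod w * cmod z \<le> 1 * cmod z"
    using assms by (intro mult_right_mono) auto
  ultimately show False
    using assms by auto
qed

lemma norm_one_minus_cnj_mult_sq:
  "(cmod (1 - cnj w * z))\<^sup>2 - (cmod (z - w))\<^sup>2 = (1 - (cmod z)\<^sup>2) * (1 - (cmod w)\<^sup>2)"
  by (simp only: cmod_power2) (simp add: algebra_simps power2_eq_square)

text \<open>Conjugating \<open>f\<close> by disc automorphisms so that \<open>w\<close> and \<open>f w\<close> move to \<open>0\<close> turns the
  claim into the Schwarz lemma.\<close>

theorem schwarz_pick:
  assumes f: "f holomorphic_on unit_disc" "f ` unit_disc \<subseteq> unit_disc"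
    and z: "z \<in> unit_disc" and w: "w \<in> unit_disc"
  shows "pdist (f z) (f w) \<le> pdist z w"
proof -
  define F where "F = Moebius_function 0 (f w) \<circ> (f \<circ> Moebius_function 0 (-w))"
  have fw: "cmod (f w) < 1" and w1: "cmod w < 1" and z1: "cmod z < 1"
    using subsetD[OF f(2) imageI[OF w]] w z by auto
  have m1: "Moebius_function 0 (-w) ` unit_disc \<subseteq> unit_disc"
    using Moebius_function_norm_lt_1[of "-w"] w1 by auto
  have h1: "f \<circ> Moebius_function 0 (-w) holomorphic_on unit_disc"
    using Moebius_function_holomorphic[of "-w"] w1
    by (intro holomorphic_on_compose_gen[OF _ f(1)] m1) auto
  have hF: "F holomorphic_on unit_disc"
    unfolding F_def
  proof (rule holomorphic_on_compose_gen[OF h1 Moebius_function_holomorphic[OF fw]])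
    show "(f \<circ> Moebius_function 0 (-w)) ` unit_disc \<subseteq> unit_disc"
      using f(2) m1 unfolding image_comp[symmetric] by blast
  qed
  have "F 0 = 0"
    by (simp add: F_def Moebius_function_of_zero Moebius_function_eq_zero)
  moreover have "cmod (F u) < 1" if "cmod u < 1" for u
  proof -
    have "f (Moebius_function 0 (-w) u) \<in> unit_disc"
      using m1 f that by (auto simp: image_subset_iff)
    then show ?thesis
      unfolding F_def using Moebius_function_norm_lt_1[OF fw] by auto
  qed
  moreover have "cmod (Moebius_function 0 w z) < 1"
    by (rule Moebius_function_norm_lt_1[OF w1 z1])
  ultimately have "cmod (F (Moebius_function 0 w z)) \<le> cmod (Moebius_function 0 w z)"
    by (intro Schwarz_Lemma(1)[OF hF]) auto
  moreover have "Moebius_function 0 (-w) (Moebius_function 0 w z) = z"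
    by (rule Moebius_function_compose) (use w1 z1 in auto)
  ultimately show ?thesis
    by (simp add: F_def pdist_def)
qed

lemma pdist_less_one:
  assumes "cmod z < 1" "cmod w < 1"
  shows "pdist z w < 1"
  unfolding pdist_def by (rule Moebius_function_norm_lt_1) (use assms in auto)

text \<open>Once the common factor \<open>1 - \<bar>w\<bar>\<^sup>2\<close> is cancelled, comparing distances to \<open>w\<close> remains
  meaningful when \<open>w\<close> tends to the unit circle, where it becomes a comparison of horodiscs.\<close>

lemma pdist_le_iff_sq:
  assumes "cmod z < 1" "cmod w < 1" "cmod z' < 1"
  shows "pdist z' w \<le> pdist z w \<longleftrightarrow>
     (cmod (1 - cnj w * z'))\<^sup>2 * (1 - (cmod z)\<^sup>2) \<le> (cmod (1 - cnj w * z))\<^sup>2 * (1 - (cmod z')\<^sup>2)"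
proof -
  define A where "A = (cmod (1 - cnj w * z))\<^sup>2"
  define A' where "A' = (cmod (1 - cnj w * z'))\<^sup>2"
  have pos: "A > 0" "A' > 0"
    using one_minus_cnj_mult_nonzero[of z w] one_minus_cnj_mult_nonzero[of z' w] assms
    by (auto simp: A_def A'_def)
  have e: "(pdist z w)\<^sup>2 = (A - (1 - (cmod z)\<^sup>2) * (1 - (cmod w)\<^sup>2)) / A"
    using norm_one_minus_cnj_mult_sq[of w z]
    by (simp add: pdist_def Moebius_function_simple norm_divide power_divide A_def)
  have e': "(pdist z' w)\<^sup>2 = (A' - (1 - (cmod z')\<^sup>2) * (1 - (cmod w)\<^sup>2)) / A'"
    using norm_one_minus_cnj_mult_sq[of w z']
    by (simp add: pdist_def Moebius_function_simple norm_divide power_divide A'_def)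
  have w: "1 - (cmod w)\<^sup>2 > 0"
    using assms by (simp add: abs_square_less_1)
  have "pdist z' w \<le> pdist z w \<longleftrightarrow> (pdist z' w)\<^sup>2 \<le> (pdist z w)\<^sup>2"
    by (simp add: pdist_def)
  also have "\<dots> \<longleftrightarrow> (1 - (cmod w)\<^sup>2) * (A' * (1 - (cmod z)\<^sup>2)) \<le> (1 - (cmod w)\<^sup>2) * (A * (1 - (cmod z')\<^sup>2))"
    unfolding e e' using pos by (simp add: field_simps)
  also have "\<dots> \<longleftrightarrow> A' * (1 - (cmod z)\<^sup>2) \<le> A * (1 - (cmod z')\<^sup>2)"
    using w by simp
  finally show ?thesis
    by (simp add: A_def A'_def)
qed

text \<open>Points at bounded hyperbolic distance become close in the Euclidean sense when one of them
  approaches the unit circle.\<close>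

lemma pdist_lt_imp_near:
  assumes "cmod z < 1" "cmod w < 1" "pdist z w \<le> q"
  shows "(cmod (z - w))\<^sup>2 * (1 - q\<^sup>2) \<le> q\<^sup>2 * ((1 - (cmod z)\<^sup>2) * (1 - (cmod w)\<^sup>2))"
proof -
  have "(pdist z w)\<^sup>2 \<le> q\<^sup>2"
    using assms by (intro power_mono) (auto simp: pdist_def)
  moreover have "(cmod (1 - cnj w * z))\<^sup>2 > 0"
    using one_minus_cnj_mult_nonzero[of z w] assms by auto
  ultimately have "(cmod (z - w))\<^sup>2 \<le> q\<^sup>2 * (cmod (1 - cnj w * z))\<^sup>2"
    by (simp add: pdist_def Moebius_function_simple norm_divide power_divide field_simps)
  also have "(cmod (1 - cnj w * z))\<^sup>2 = (cmod (z - w))\<^sup>2 + (1 - (cmod z)\<^sup>2) * (1 - (cmod w)\<^sup>2)"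
    using norm_one_minus_cnj_mult_sq[of w z] by linarith
  finally show ?thesis
    by (simp add: algebra_simps)
qed

definition cayley :: "complex \<Rightarrow> complex \<Rightarrow> complex" where
  "cayley \<tau> z = (\<tau> + z) / (\<tau> - z)"

definition cayley_inv :: "complex \<Rightarrow> complex \<Rightarrow> complex" where
  "cayley_inv \<tau> w = \<tau> * (w - 1) / (w + 1)"

lemma Re_cayley:
  assumes "cmod \<tau> = 1"
  shows "Re (cayley \<tau> z) = (1 - (cmod z)\<^sup>2) / (cmod (\<tau> - z))\<^sup>2"
proof -
  have "(Re \<tau>)\<^sup>2 + (Im \<tau>)\<^sup>2 = 1"
    using assms by (simp flip: cmod_power2)
  then show ?thesis
    unfolding cayley_def Re_divide cmod_power2
    by (simp add: algebra_simps power2_eq_square)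
qed

lemma Re_cayley_pos:
  assumes "cmod \<tau> = 1" "cmod z < 1"
  shows "Re (cayley \<tau> z) > 0"
proof -
  have "\<tau> \<noteq> z" using assms by auto
  then show ?thesis
    using assms by (auto simp: Re_cayley abs_square_less_1)
qed

lemma cayley_inv_cayley:
  assumes "cmod \<tau> = 1" "cmod z < 1"
  shows "cayley_inv \<tau> (cayley \<tau> z) = z"
proof -
  have "\<tau> - z \<noteq> 0" "\<tau> \<noteq> 0" using assms by auto
  then show ?thesis
    by (simp add: cayley_def cayley_inv_def divide_simps)
qed

lemma cayley_cayley_inv:
  assumes "cmod \<tau> = 1" "Re w > 0"
  shows "cayley \<tau> (cayley_inv \<tau> w) = w"
proof -
  have "\<tau> \<noteq> 0" "w + 1 \<noteq> 0"
    using assms by (auto simp: complex_eq_iff[of "w + 1"])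
  then show ?thesis
    by (simp add: cayley_def cayley_inv_def divide_simps) (simp add: algebra_simps)
qed

lemma cayley_inv_in_disc:
  assumes "cmod \<tau> = 1" "Re w > 0"
  shows "cmod (cayley_inv \<tau> w) < 1"
proof -
  have "w + 1 \<noteq> 0"
    using assms by (auto simp: complex_eq_iff)
  moreover have "(cmod (w - 1))\<^sup>2 < (cmod (w + 1))\<^sup>2"
    using assms unfolding cmod_power2 by (simp add: algebra_simps power2_eq_square)
  then have "cmod (w - 1) < cmod (w + 1)"
    by (simp add: power_less_imp_less_base)
  ultimately show ?thesis
    using assms by (simp add: cayley_inv_def norm_mult norm_divide)
qed

lemma cayley_holomorphic: "cmod \<tau> = 1 \<Longrightarrow> cayley \<tau> holomorphic_on unit_disc"
  unfolding cayley_def by (intro holomorphic_intros) auto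

lemma cayley_inv_holomorphic: "cayley_inv \<tau> holomorphic_on {w. 0 < Re w}"
  unfolding cayley_inv_def
  by (intro holomorphic_intros) (auto simp: complex_eq_iff)

lemma pdist_cayley:
  assumes "cmod \<tau> = 1" "cmod z < 1" "cmod w < 1"
  shows "pdist z w = cmod (cayley \<tau> z - cayley \<tau> w) / cmod (cayley \<tau> z + cnj (cayley \<tau> w))"
proof -
  have \<tau>: "cnj \<tau> * \<tau> = 1"
    using assms(1) by (metis complex_cnj_mult complex_mod_mult_cnj complex_norm_square mult.commute norm_one of_real_1 power_one)
  have nz: "\<tau> - z \<noteq> 0" "\<tau> - w \<noteq> 0" "cnj \<tau> - cnj w \<noteq> 0"
    using assms by (auto simp flip: complex_cnj_diff)
  have "cayley \<tau> z - cayley \<tau> w = 2 * \<tau> * (z - w) / ((\<tau> - z) * (\<tau> - w))"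
    using nz by (simp add: cayley_def field_simps)
  then have "cmod (cayley \<tau> z - cayley \<tau> w) = 2 * cmod (z - w) / (cmod (\<tau> - z) * cmod (\<tau> - w))"
    using assms(1) by (simp add: norm_divide norm_mult)
  moreover have "cayley \<tau> z + cnj (cayley \<tau> w) = 2 * (1 - cnj w * z) / ((\<tau> - z) * (cnj \<tau> - cnj w))"
    using nz \<tau> by (simp add: cayley_def field_simps)
  then have "cmod (cayley \<tau> z + cnj (cayley \<tau> w)) = 2 * cmod (1 - cnj w * z) / (cmod (\<tau> - z) * cmod (\<tau> - w))"
    using complex_mod_cnj[of "\<tau> - w"] by (simp only: norm_divide norm_mult) simp
  ultimately show ?thesis
    using nz assms(1) by (simp add: pdist_def Moebius_function_simple norm_divide norm_mult)
qed

section \<open>Wolff's lemma and the Denjoy--Wolff point\<close>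

text \<open>The maps \<open>r\<^sub>n f\<close>, where \<open>r\<^sub>n < 1\<close> and \<open>r\<^sub>n \<rightarrow> 1\<close>, have fixed points \<open>p\<^sub>n\<close> by Brouwer's theorem.
  These can only accumulate at a point \<open>\<tau>\<close> of the unit circle, because an interior limit would be fixed by
  \<open>f\<close>. Schwarz--Pick discs around \<open>p\<^sub>n\<close> then degenerate to horodiscs at \<open>\<tau>\<close>, which are the
  half-planes \<open>Re w \<ge> a\<close> in the coordinate \<open>w = cayley \<tau> z\<close>.\<close>

theorem wolff_lemma:
  assumes f: "f holomorphic_on unit_disc" "f ` unit_disc \<subseteq> unit_disc"
    and nofix: "\<And>z. z \<in> unit_disc \<Longrightarrow> f z \<noteq> z"
  obtains \<tau> where "cmod \<tau> = 1"
    "\<And>z. z \<in> unit_disc \<Longrightarrow> Re (cayley \<tau> z) \<le> Re (cayley \<tau> (f z))"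
proof -
  have fD: "cmod (f z) < 1" if "cmod z < 1" for z
    using subsetD[OF f(2) imageI[of z]] that by auto
  define r :: "nat \<Rightarrow> real" where "r n = 1 - inverse (of_nat (Suc n))" for n
  have r: "0 \<le> r n" "r n < 1" for n
    by (auto simp: r_def field_simps)
  have r_lim: "r \<longlonglongrightarrow> 1"
    unfolding r_def using tendsto_diff[OF tendsto_const LIMSEQ_inverse_real_of_nat, of 1] by simp
  have "\<exists>p. cmod p < 1 \<and> of_real (r n) * f p = p" for n
  proof -
    have "cmod (of_real (r n) * f p) \<le> r n" if "cmod p < 1" for p
      using fD[OF that] r[of n] mult_left_mono[of "cmod (f p)" 1 "r n"] by (simp add: norm_mult)
    moreover have "cmod p < 1" if "cmod p \<le> r n" for p
      using that r[of n] by auto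
    moreover have "continuous_on (cball 0 (r n)) (\<lambda>p. of_real (r n) * f p)"
      by (intro continuous_intros continuous_on_subset[OF holomorphic_on_imp_continuous_on[OF f(1)]])
         (use r[of n] in auto)
    ultimately obtain p where "p \<in> cball 0 (r n)" "of_real (r n) * f p = p"
      using r[of n] by (auto intro: brouwer[of "cball 0 (r n)" "\<lambda>p. of_real (r n) * f p"])
    then show ?thesis
      using r[of n] by (intro exI[of _ p]) auto
  qed
  then obtain p where p: "\<And>n. cmod (p n) < 1" "\<And>n. of_real (r n) * f (p n) = p n"
    by metis
  have "\<And>n. p n \<in> cball 0 1"
    using p(1) less_imp_le by auto
  then obtain \<tau> s where \<tau>: "\<tau> \<in> cball 0 1" and s: "strict_mono s" and lim: "(p \<circ> s) \<longlonglongrightarrow> \<tau>"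
    using compact_cball[of "0::complex" 1] unfolding compact_def by metis
  have r_s: "(\<lambda>n. r (s n)) \<longlonglongrightarrow> 1"
    using LIMSEQ_subseq_LIMSEQ[OF r_lim s] by (simp add: o_def)
  have p_s: "(\<lambda>n. p (s n)) \<longlonglongrightarrow> \<tau>"
    using lim by (simp add: o_def)
  have "cmod \<tau> = 1"
  proof (rule ccontr)
    assume "cmod \<tau> \<noteq> 1"
    then have \<tau>1: "\<tau> \<in> unit_disc" using \<tau> by auto
    then have "isCont f \<tau>"
      using holomorphic_on_imp_continuous_on[OF f(1)] by (simp add: continuous_on_eq_continuous_at)
    then have "(\<lambda>n. of_real (r (s n)) * f (p (s n))) \<longlonglongrightarrow> of_real 1 * f \<tau>"
      by (intro tendsto_intros r_s isCont_tendsto_compose[OF _ p_s])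
    then have "(\<lambda>n. p (s n)) \<longlonglongrightarrow> f \<tau>"
      using p(2) by simp
    then have "f \<tau> = \<tau>"
      using p_s LIMSEQ_unique by blast
    then show False using nofix \<tau>1 by blast
  qed
  moreover have "Re (cayley \<tau> z) \<le> Re (cayley \<tau> (f z))" if z: "z \<in> unit_disc" for z
  proof -
    define g where "g n = of_real (r n) * f z" for n
    have g_lim: "(\<lambda>n. g (s n)) \<longlonglongrightarrow> of_real 1 * f z"
      unfolding g_def by (intro tendsto_intros r_s)
    have "(cmod (1 - cnj (p n) * g n))\<^sup>2 * (1 - (cmod z)\<^sup>2)
       \<le> (cmod (1 - cnj (p n) * z))\<^sup>2 * (1 - (cmod (g n))\<^sup>2)" for n
    proof -
      let ?f = "\<lambda>z. of_real (r n) * f z"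
      have im: "cmod (?f z) < 1" if "cmod z < 1" for z
        using fD[OF that] r[of n] mult_left_mono[of "cmod (f z)" 1 "r n"] by (simp add: norm_mult)
      have "pdist (?f z) (?f (p n)) \<le> pdist z (p n)"
        using z p(1)[of n] im by (intro schwarz_pick holomorphic_intros f) auto
      then have "pdist (g n) (p n) \<le> pdist z (p n)"
        using p(2)[of n] by (simp add: g_def)
      then show ?thesis
        using pdist_le_iff_sq[of z "p n" "g n"] p(1)[of n] z im[of z] by (simp add: g_def)
    qed
    then have le: "\<exists>N. \<forall>n\<ge>N. (cmod (1 - cnj (p (s n)) * g (s n)))\<^sup>2 * (1 - (cmod z)\<^sup>2)
       \<le> (cmod (1 - cnj (p (s n)) * z))\<^sup>2 * (1 - (cmod (g (s n)))\<^sup>2)"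
      by blast
    have "(cmod (1 - cnj \<tau> * (of_real 1 * f z)))\<^sup>2 * (1 - (cmod z)\<^sup>2)
       \<le> (cmod (1 - cnj \<tau> * z))\<^sup>2 * (1 - (cmod (of_real 1 * f z))\<^sup>2)"
      by (rule LIMSEQ_le[OF _ _ le]; intro tendsto_intros p_s g_lim)
    moreover have "cmod (1 - cnj \<tau> * w) = cmod (\<tau> - w)" for w
    proof -
      have "cnj \<tau> * \<tau> = 1"
        using \<open>cmod \<tau> = 1\<close> complex_norm_square[of \<tau>] by (simp add: mult.commute)
      then have "1 - cnj \<tau> * w = cnj \<tau> * (\<tau> - w)"
        by (simp add: algebra_simps)
      then show ?thesis
        using \<open>cmod \<tau> = 1\<close> by (simp add: norm_mult)
    qed
    moreover have "(cmod (\<tau> - z))\<^sup>2 > 0" "(cmod (\<tau> - f z))\<^sup>2 > 0"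
      using z fD[of z] \<open>cmod \<tau> = 1\<close> by auto
    ultimately show ?thesis
      using \<open>cmod \<tau> = 1\<close> by (simp add: Re_cayley field_simps)
  qed
  ultimately show ?thesis
    using that by blast
qed

lemma disc_semigroupD:
  assumes "disc_semigroup \<phi>"
  shows "\<And>t. t \<ge> 0 \<Longrightarrow> \<phi> t holomorphic_on unit_disc"
    and "\<And>t. t \<ge> 0 \<Longrightarrow> \<phi> t ` unit_disc \<subseteq> unit_disc"
    and "\<And>t z. t \<ge> 0 \<Longrightarrow> cmod z < 1 \<Longrightarrow> cmod (\<phi> t z) < 1"
    and "\<And>z. cmod z < 1 \<Longrightarrow> \<phi> 0 z = z"
    and "\<And>s t z. s \<ge> 0 \<Longrightarrow> t \<ge> 0 \<Longrightarrow> cmod z < 1 \<Longrightarrow> \<phi> (s + t) z = \<phi> s (\<phi> t z)"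
proof -
  note A = assms[unfolded disc_semigroup_def]
  show hol: "\<And>t. t \<ge> 0 \<Longrightarrow> \<phi> t holomorphic_on unit_disc"
    and sub: "\<And>t. t \<ge> 0 \<Longrightarrow> \<phi> t ` unit_disc \<subseteq> unit_disc"
    using conjunct1[OF A] by blast+
  show "\<And>t z. t \<ge> 0 \<Longrightarrow> cmod z < 1 \<Longrightarrow> cmod (\<phi> t z) < 1"
    using sub by (simp add: image_subset_iff)
  show "\<And>z. cmod z < 1 \<Longrightarrow> \<phi> 0 z = z"
    using conjunct1[OF conjunct2[OF A]] by simp
  show "\<And>s t z. s \<ge> 0 \<Longrightarrow> t \<ge> 0 \<Longrightarrow> cmod z < 1 \<Longrightarrow> \<phi> (s + t) z = \<phi> s (\<phi> t z)"
    using conjunct1[OF conjunct2[OF conjunct2[OF A]]] by simp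
qed

lemma continuous_on_semigroup_orbit:
  assumes \<phi>: "disc_semigroup \<phi>" and z: "cmod z < 1"
  shows "continuous_on {0..} (\<lambda>t. \<phi> t z)"
  unfolding continuous_on_def
proof
  fix t :: real assume "t \<in> {0..}"
  then have "uniform_limit {z} \<phi> (\<phi> t) (at t within {0..})"
    using conjunct2[OF conjunct2[OF conjunct2[OF \<phi>[unfolded disc_semigroup_def]]]] z
    by (auto dest!: spec[of _ t] spec[of _ "{z}"])
  then show "((\<lambda>t. \<phi> t z) \<longlongrightarrow> \<phi> t z) (at t within {0..})"
    by (rule tendsto_uniform_limitI) simp
qed

lemma koenigs_functionD:
  assumes "koenigs_function \<phi> h"
  shows "h holomorphic_on unit_disc" "inj_on h unit_disc"
    "\<And>t z. t \<ge> 0 \<Longrightarrow> cmod z < 1 \<Longrightarrow> h (\<phi> t z) = h z + \<i> * of_real t"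
  using assms by (simp_all add: koenigs_function_def)

text \<open>On a compact subset of the disc \<open>h\<close> is bounded, while \<open>h (\<phi> t z) = h z + \<i> t\<close> is not.\<close>

lemma orbit_tends_to_boundary:
  assumes \<phi>: "disc_semigroup \<phi>" and h: "koenigs_function \<phi> h" and z: "cmod z < 1"
  shows "((\<lambda>t. cmod (\<phi> t z)) \<longlongrightarrow> 1) at_top"
proof (rule order_tendstoI)
  fix a :: real assume "a > 1"
  then show "\<forall>\<^sub>F t in at_top. cmod (\<phi> t z) < a"
    using disc_semigroupD(3)[OF \<phi> _ z] by (auto simp: eventually_at_top_linorder intro!: exI[of _ 0] less_trans[of _ 1 a])
next
  fix a :: real assume a: "a < 1"
  have "continuous_on (cball 0 a) h"
    by (rule continuous_on_subset[OF holomorphic_on_imp_continuous_on[OF koenigs_functionD(1)[OF h]]])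
      (use a in auto)
  then have "bounded (h ` cball 0 a)"
    by (intro compact_imp_bounded compact_continuous_image compact_cball)
  then obtain B where "\<forall>x\<in>h ` cball 0 a. cmod x \<le> B"
    unfolding bounded_iff by blast
  then have B: "\<And>w. cmod w \<le> a \<Longrightarrow> cmod (h w) \<le> B"
    by simp
  have "cmod (\<phi> t z) > a" if t: "t \<ge> max 0 (B + cmod (h z) + 1)" for t
  proof (rule ccontr)
    assume "\<not> cmod (\<phi> t z) > a"
    then have "cmod (h z + \<i> * of_real t) \<le> B"
      using B[of "\<phi> t z"] koenigs_functionD(3)[OF h _ z, of t] t by auto
    moreover have "t \<le> cmod (h z + \<i> * of_real t) + cmod (h z)"
      using norm_triangle_ineq4[of "h z + \<i> * of_real t" "h z"] t by (simp add: norm_mult)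
    ultimately show False
      using t by auto
  qed
  then show "\<forall>\<^sub>F t in at_top. a < cmod (\<phi> t z)"
    using eventually_at_top_linorder by blast
qed

text \<open>The iterates of \<open>0\<close> never leave the horodisc at \<open>\<tau>\<close> through \<open>0\<close> and tend to the unit
  circle, and \<open>\<tau>\<close> is the only point of the circle in the closure of that horodisc.\<close>

lemma wolff_point_is_limit:
  assumes \<phi>: "disc_semigroup \<phi>" and h: "koenigs_function \<phi> h" and t: "t > 0" and \<tau>: "cmod \<tau> = 1"
    and J: "\<And>z. z \<in> unit_disc \<Longrightarrow> Re (cayley \<tau> z) \<le> Re (cayley \<tau> (\<phi> t z))"
  shows "(\<lambda>n. \<phi> (real n * t) 0) \<longlonglongrightarrow> \<tau>"
proof -
  let ?z = "\<lambda>n. \<phi> (real n * t) 0"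
  have z1: "cmod (?z n) < 1" for n
    using disc_semigroupD(3)[OF \<phi>, of "real n * t" 0] t by auto
  have "Re (cayley \<tau> (?z n)) \<ge> 1" for n
  proof (induction n)
    case 0
    have "\<tau> \<noteq> 0" using \<tau> by auto
    then show ?case
      using disc_semigroupD(4)[OF \<phi>, of 0] by (simp add: cayley_def)
  next
    case (Suc n)
    have "?z (Suc n) = \<phi> t (?z n)"
      using disc_semigroupD(5)[OF \<phi>, of t "real n * t" 0] t by (simp add: algebra_simps)
    then show ?case
      using J[of "?z n"] z1[of n] Suc by auto
  qed
  then have "(cmod (?z n - \<tau>))\<^sup>2 \<le> 1 - (cmod (?z n))\<^sup>2" for n
  proof -
    have "\<tau> \<noteq> ?z n" using z1[of n] \<tau> by auto
    then show ?thesis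
      using \<open>\<And>n. Re (cayley \<tau> (?z n)) \<ge> 1\<close>[of n] \<tau> by (simp add: Re_cayley field_simps norm_minus_commute)
  qed
  moreover have "(\<lambda>n. 1 - (cmod (?z n))\<^sup>2) \<longlonglongrightarrow> 1 - 1\<^sup>2"
  proof (intro tendsto_intros)
    have "filterlim (\<lambda>n. real n * t) at_top sequentially"
      using filterlim_tendsto_pos_mult_at_top[OF tendsto_const t filterlim_real_sequentially]
      by (simp add: mult.commute)
    then show "(\<lambda>n. cmod (?z n)) \<longlonglongrightarrow> 1"
      using filterlim_compose[OF orbit_tends_to_boundary[OF \<phi> h, of 0]] by simp
  qed
  ultimately have "(\<lambda>n. (cmod (?z n - \<tau>))\<^sup>2) \<longlonglongrightarrow> 0"
    using tendsto_sandwich[of "\<lambda>_. 0" "\<lambda>n. (cmod (?z n - \<tau>))\<^sup>2" sequentially "\<lambda>n. 1 - (cmod (?z n))\<^sup>2" 0]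
    by simp
  then have "(\<lambda>n. sqrt ((cmod (?z n - \<tau>))\<^sup>2)) \<longlonglongrightarrow> sqrt 0"
    by (rule tendsto_real_sqrt)
  then have "(\<lambda>n. ?z n - \<tau>) \<longlonglongrightarrow> 0"
    by (simp add: tendsto_norm_zero_iff)
  then show ?thesis
    by (rule LIM_zero_cancel)
qed

text \<open>Wolff's lemma for \<open>\<phi> 1\<close> gives the limit \<open>\<sigma>\<close> of \<open>\<phi> n 0\<close>. A point \<open>\<phi> t z\<close> equals
  \<open>\<phi> n (\<phi> r z)\<close> with \<open>n = \<lfloor>t\<rfloor>\<close> and \<open>r < 1\<close>, hence its hyperbolic distance from \<open>\<phi> n 0\<close> is bounded,
  and it has the same limit. Wolff's lemma for \<open>\<phi> t\<close> yields a boundary point that is the limit of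
  the subsequence \<open>\<phi> (n t) 0\<close>, so it is again \<open>\<sigma>\<close>: all horodiscs at \<open>\<sigma>\<close> are invariant under the
  whole semigroup.\<close>

theorem denjoy_wolff:
  assumes \<phi>: "disc_semigroup \<phi>" and h: "koenigs_function \<phi> h"
  defines "\<tau> \<equiv> denjoy_wolff_point \<phi>"
  shows "cmod \<tau> = 1"
    and "\<And>z. cmod z < 1 \<Longrightarrow> ((\<lambda>t. \<phi> t z) \<longlongrightarrow> \<tau>) at_top"
    and "\<And>t z. t \<ge> 0 \<Longrightarrow> cmod z < 1 \<Longrightarrow> Re (cayley \<tau> z) \<le> Re (cayley \<tau> (\<phi> t z))"
proof -
  note S = disc_semigroupD[OF \<phi>]
  have nofix: "\<phi> t z \<noteq> z" if "t > 0" "z \<in> unit_disc" for t z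
  proof
    assume "\<phi> t z = z"
    moreover have "h (\<phi> t z) = h z + \<i> * of_real t"
      using koenigs_functionD(3)[OF h, of t z] that by simp
    ultimately show False
      using that(1) by simp
  qed
  have wolff: "\<exists>\<sigma>. cmod \<sigma> = 1 \<and> (\<forall>z. cmod z < 1 \<longrightarrow> Re (cayley \<sigma> z) \<le> Re (cayley \<sigma> (\<phi> t z)))
      \<and> (\<lambda>n. \<phi> (real n * t) 0) \<longlonglongrightarrow> \<sigma>" if "t > 0" for t
  proof -
    have t: "t \<ge> 0" using that by simp
    show ?thesis
    proof (rule wolff_lemma[OF S(1)[OF t] S(2)[OF t]])
      fix \<sigma> assume "cmod \<sigma> = 1" "\<And>z. z \<in> unit_disc \<Longrightarrow> Re (cayley \<sigma> z) \<le> Re (cayley \<sigma> (\<phi> t z))"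
      then show ?thesis
        using wolff_point_is_limit[OF \<phi> h that, of \<sigma>] by auto
    qed (rule nofix[OF that])
  qed
  from wolff[of 1] obtain \<sigma> where \<sigma>: "cmod \<sigma> = 1" and \<sigma>_lim: "(\<lambda>n. \<phi> (real n) 0) \<longlonglongrightarrow> \<sigma>"
    by auto
  have lim: "((\<lambda>t. \<phi> t z) \<longlongrightarrow> \<sigma>) at_top" if z: "cmod z < 1" for z
  proof -
    have "compact ((\<lambda>t. \<phi> t z) ` {0..1})"
      by (intro compact_continuous_image continuous_on_subset[OF continuous_on_semigroup_orbit[OF \<phi> z]]) auto
    then obtain t0 where t0: "t0 \<in> {0..1}" "\<And>t. t \<in> {0..1} \<Longrightarrow> cmod (\<phi> t z) \<le> cmod (\<phi> t0 z)"
      using continuous_attains_sup[of "{0..1::real}" "\<lambda>t. cmod (\<phi> t z)"]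
        continuous_on_norm[OF continuous_on_subset[OF continuous_on_semigroup_orbit[OF \<phi> z]], of "{0..1}"]
      by auto
    define q where "q = cmod (\<phi> t0 z)"
    have q: "0 \<le> q" "q < 1" using S(3)[of t0 z] t0 z by (auto simp: q_def)
    then have q2: "1 - q\<^sup>2 > 0" by (simp add: abs_square_less_1)
    define N where "N t = nat \<lfloor>t\<rfloor>" for t :: real
    \<comment> \<open>The first summand bounds the distance from \<open>\<phi> t z\<close> to \<open>\<phi> n 0\<close>, the second one the distance
      from there to the limit.\<close>
    define E where "E n = sqrt (q\<^sup>2 / (1 - q\<^sup>2) * (1 - (cmod (\<phi> (real n) 0))\<^sup>2)) + cmod (\<phi> (real n) 0 - \<sigma>)" for n
    have "cmod (\<phi> t z - \<sigma>) \<le> E (N t)" if t: "t \<ge> 0" for t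
    proof -
      define n where "n = N t"
      define r where "r = t - real n"
      have r: "0 \<le> r" "r \<le> 1" using t by (auto simp: r_def n_def N_def) linarith
      have eq: "\<phi> t z = \<phi> (real n) (\<phi> r z)"
        using S(5)[of "real n" r z] r z by (simp add: r_def)
      have c: "cmod (\<phi> r z) < 1" "cmod (\<phi> r z) \<le> q"
        using S(3) r z t0(2)[of r] by (auto simp: q_def)
      have n1: "cmod (\<phi> (real n) 0) < 1" "cmod (\<phi> t z) < 1" using S(3) t z by auto
      have "pdist (\<phi> (real n) (\<phi> r z)) (\<phi> (real n) 0) \<le> pdist (\<phi> r z) 0"
        by (rule schwarz_pick) (use S(1,2) c in auto)
      also have "\<dots> \<le> q"
        using c by (simp add: pdist_def Moebius_function_simple)
      finally have "(cmod (\<phi> t z - \<phi> (real n) 0))\<^sup>2 * (1 - q\<^sup>2) \<le> q\<^sup>2 * ((1 - (cmod (\<phi> t z))\<^sup>2) * (1 - (cmod (\<phi> (real n) 0))\<^sup>2))"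
        using n1 by (intro pdist_lt_imp_near) (auto simp: eq)
      also have "\<dots> \<le> q\<^sup>2 * (1 * (1 - (cmod (\<phi> (real n) 0))\<^sup>2))"
        using n1 by (intro mult_left_mono mult_right_mono) (auto simp: abs_square_le_1)
      finally have "(cmod (\<phi> t z - \<phi> (real n) 0))\<^sup>2 \<le> q\<^sup>2 / (1 - q\<^sup>2) * (1 - (cmod (\<phi> (real n) 0))\<^sup>2)"
        using q2 by (simp add: field_simps)
      then have "cmod (\<phi> t z - \<phi> (real n) 0) \<le> sqrt (q\<^sup>2 / (1 - q\<^sup>2) * (1 - (cmod (\<phi> (real n) 0))\<^sup>2))"
        by (rule real_le_rsqrt)
      then show ?thesis
        using norm_triangle_ineq[of "\<phi> t z - \<phi> (real n) 0" "\<phi> (real n) 0 - \<sigma>"]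
        by (simp add: E_def n_def)
    qed
    moreover have "(\<lambda>n. E n) \<longlonglongrightarrow> 0"
    proof -
      have "(\<lambda>n. cmod (\<phi> (real n) 0)) \<longlonglongrightarrow> cmod \<sigma>"
        by (intro tendsto_intros \<sigma>_lim)
      then have "E \<longlonglongrightarrow> sqrt (q\<^sup>2 / (1 - q\<^sup>2) * (1 - (cmod \<sigma>)\<^sup>2)) + cmod (\<sigma> - \<sigma>)"
        unfolding E_def by (intro tendsto_intros \<sigma>_lim)
      then show ?thesis using \<sigma> by simp
    qed
    moreover have "filterlim N sequentially at_top"
      unfolding N_def by (rule filterlim_compose[OF filterlim_nat_sequentially filterlim_floor_sequentially])
    ultimately have "((\<lambda>t. \<phi> t z - \<sigma>) \<longlongrightarrow> 0) at_top"
      by (intro Lim_null_comparison[OF eventually_mono[OF eventually_ge_at_top[of 0]] filterlim_compose[of E]])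
    then show ?thesis by (simp add: LIM_zero_iff)
  qed
  have "\<tau> = \<sigma>"
    unfolding \<tau>_def denjoy_wolff_point_def
  proof (rule the_equality)
    show "\<sigma> \<in> sphere 0 1 \<and> (\<forall>z\<in>unit_disc. ((\<lambda>t. \<phi> t z) \<longlongrightarrow> \<sigma>) at_top)"
      using \<sigma> lim by auto
  next
    fix \<rho> assume "\<rho> \<in> sphere 0 1 \<and> (\<forall>z\<in>unit_disc. ((\<lambda>t. \<phi> t z) \<longlongrightarrow> \<rho>) at_top)"
    then have "((\<lambda>t. \<phi> t 0) \<longlongrightarrow> \<rho>) at_top" by auto
    then show "\<rho> = \<sigma>"
      using lim[of 0] tendsto_unique[of at_top "\<lambda>t. \<phi> t 0"] by auto
  qed
  then show "cmod \<tau> = 1" and "\<And>z. cmod z < 1 \<Longrightarrow> ((\<lambda>t. \<phi> t z) \<longlongrightarrow> \<tau>) at_top"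
    using \<sigma> lim by auto
  fix t z assume t: "t \<ge> (0::real)" and z: "cmod z < 1"
  show "Re (cayley \<tau> z) \<le> Re (cayley \<tau> (\<phi> t z))"
  proof (cases "t = 0")
    case True
    then show ?thesis using S(4)[OF z] by simp
  next
    case False
    with t have t: "t > 0" by simp
    from wolff[OF t] obtain \<rho> where \<rho>: "\<forall>z. cmod z < 1 \<longrightarrow> Re (cayley \<rho> z) \<le> Re (cayley \<rho> (\<phi> t z))"
      and "(\<lambda>n. \<phi> (real n * t) 0) \<longlonglongrightarrow> \<rho>" by blast
    moreover have "filterlim (\<lambda>n. real n * t) at_top sequentially"
      using filterlim_tendsto_pos_mult_at_top[OF tendsto_const t filterlim_real_sequentially]
      by (simp add: mult.commute)
    then have "(\<lambda>n. \<phi> (real n * t) 0) \<longlonglongrightarrow> \<sigma>"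
      using filterlim_compose[OF lim[of 0]] by simp
    ultimately have "\<rho> = \<tau>"
      using \<open>\<tau> = \<sigma>\<close> LIMSEQ_unique by blast
    then show ?thesis using \<rho> z by auto
  qed
qed

section \<open>The speeds in the half-plane coordinate\<close>

lemma artanh_le_artanh_iff:
  fixes x y :: real
  assumes "0 \<le> x" "x < 1" "0 \<le> y" "y < 1"
  shows "artanh x \<le> artanh y \<longleftrightarrow> x \<le> y"
proof -
  have "artanh x \<le> artanh y \<longleftrightarrow> (1 + x) / (1 - x) \<le> (1 + y) / (1 - y)"
    using assms by (simp add: artanh_def)
  also have "\<dots> \<longleftrightarrow> x \<le> y"
    using assms by (simp add: field_simps)
  finally show ?thesis .
qed

lemma pdist_nonneg: "pdist z w \<ge> 0"
  by (simp add: pdist_def)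

lemma hyp_dist_le_iff:
  assumes "cmod z < 1" "cmod w < 1" "cmod z' < 1" "cmod w' < 1"
  shows "hyp_dist z w \<le> hyp_dist z' w' \<longleftrightarrow> pdist z w \<le> pdist z' w'"
  unfolding hyp_dist_eq_artanh_pdist
  using assms by (intro artanh_le_artanh_iff pdist_nonneg pdist_less_one)

lemma diameter_geodesic_eq:
  assumes "cmod \<tau> = 1"
  shows "diameter_geodesic \<tau> = (\<lambda>x. cayley_inv \<tau> (of_real x)) ` {0<..}"
proof -
  have 1: "of_real r * \<tau> = cayley_inv \<tau> (of_real ((1 + r) / (1 - r)))" if "r < 1" for r
  proof -
    have "of_real 1 - (of_real r :: complex) \<noteq> 0" using that by (simp flip: of_real_diff)
    then show ?thesis by (simp add: cayley_inv_def field_simps)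
  qed
  have 2: "cayley_inv \<tau> (of_real x) = of_real ((x - 1) / (x + 1)) * \<tau>" for x
    by (simp add: cayley_inv_def)
  show ?thesis
  proof (intro equalityI subsetI)
    fix p assume "p \<in> diameter_geodesic \<tau>"
    then obtain r where "-1 < r" "r < 1" "p = of_real r * \<tau>"
      by (auto simp: diameter_geodesic_def)
    then show "p \<in> (\<lambda>x. cayley_inv \<tau> (of_real x)) ` {0<..}"
      by (intro image_eqI[of _ _ "(1 + r) / (1 - r)"]) (simp_all add: 1)
  next
    fix p assume "p \<in> (\<lambda>x. cayley_inv \<tau> (of_real x)) ` {0<..}"
    then obtain x where "x > 0" "p = cayley_inv \<tau> (of_real x)" by auto
    then show "p \<in> diameter_geodesic \<tau>"
      unfolding diameter_geodesic_def
      by (intro image_eqI[of _ _ "(x - 1) / (x + 1)"]) (simp_all add: 2 field_simps)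
  qed
qed

text \<open>In the half-plane the pseudo-hyperbolic distance from \<open>w\<close> to \<open>x > 0\<close> is
  \<open>\<bar>w - x\<bar> / \<bar>w + x\<bar>\<close>. Squaring and cross-multiplying, the comparison of \<open>x\<close> with \<open>\<bar>w\<bar>\<close> is decided
  by the sign of \<open>4 \<bar>w\<bar> Re w (\<bar>w\<bar> - x)\<^sup>2\<close>.\<close>

lemma norm_closest_real_point:
  assumes "Re w > 0" "x > 0"
  defines "D \<equiv> \<lambda>x. cmod (w - of_real x) / cmod (w + of_real x)"
  shows "D (cmod w) \<le> D x" and "D x \<le> D (cmod w) \<Longrightarrow> x = cmod w"
proof -
  define a where "a = cmod w"
  have a: "a > 0" using assms(1,2) by (auto simp: a_def)
  have nz: "cmod (w + of_real y) > 0" if "y > 0" for y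
    using assms(1,2) that by (auto simp: complex_eq_iff)
  have eq: "(cmod (w - of_real x))\<^sup>2 * (cmod (w + of_real a))\<^sup>2
     - (cmod (w - of_real a))\<^sup>2 * (cmod (w + of_real x))\<^sup>2 = 4 * a * Re w * (a - x)\<^sup>2"
  proof -
    have minus: "(cmod (w - of_real y))\<^sup>2 = a\<^sup>2 - 2 * y * Re w + y\<^sup>2" for y
      unfolding a_def cmod_power2 by (simp add: power2_eq_square algebra_simps)
    have plus: "(cmod (w + of_real y))\<^sup>2 = a\<^sup>2 + 2 * y * Re w + y\<^sup>2" for y
      unfolding a_def cmod_power2 by (simp add: power2_eq_square algebra_simps)
    show ?thesis
      unfolding minus plus by algebra
  qed
  have iff: "D y \<le> D z \<longleftrightarrow> (cmod (w - of_real y))\<^sup>2 * (cmod (w + of_real z))\<^sup>2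
     \<le> (cmod (w - of_real z))\<^sup>2 * (cmod (w + of_real y))\<^sup>2" if "y > 0" "z > 0" for y z
  proof -
    have "D y \<le> D z \<longleftrightarrow> cmod (w - of_real y) * cmod (w + of_real z) \<le> cmod (w - of_real z) * cmod (w + of_real y)"
      using nz[OF that(1)] nz[OF that(2)] by (simp add: D_def field_simps)
    then show ?thesis
      by (simp flip: power_mult_distrib)
  qed
  show "D (cmod w) \<le> D x"
  proof -
    have "4 * a * Re w * (a - x)\<^sup>2 \<ge> 0" using a assms(1) by simp
    then show ?thesis
      using iff[OF a assms(2)] eq unfolding a_def[symmetric] by linarith
  qed
  assume "D x \<le> D (cmod w)"
  then have "4 * a * Re w * (a - x)\<^sup>2 \<le> 0"
    using iff[OF assms(2) a] eq unfolding a_def[symmetric] by linarith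
  moreover have "4 * a * Re w > 0" using a assms(1,2) by simp
  ultimately have "(a - x)\<^sup>2 \<le> 0"
    using mult_pos_pos[of "4 * a * Re w" "(a - x)\<^sup>2"] by linarith
  then show "x = cmod w" by (simp add: a_def)
qed

lemma hyp_proj_eq:
  assumes \<tau>: "cmod \<tau> = 1" and z: "cmod z < 1"
  shows "hyp_proj \<tau> z = cayley_inv \<tau> (of_real (cmod (cayley \<tau> z)))"
proof -
  define w where "w = cayley \<tau> z"
  have w: "Re w > 0" using Re_cayley_pos[OF \<tau> z] by (simp add: w_def)
  then have w0: "cmod w > 0" by auto
  define c where "c x = cayley_inv \<tau> (of_real x)" for x :: real
  have c1: "cmod (c x) < 1" if "x > 0" for x
    using cayley_inv_in_disc[OF \<tau>, of "of_real x"] that by (simp add: c_def)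
  have d: "pdist z (c x) = cmod (w - of_real x) / cmod (w + of_real x)" if "x > 0" for x
    using pdist_cayley[OF \<tau> z c1[OF that]] cayley_cayley_inv[OF \<tau>, of "of_real x"] that
    by (simp add: w_def c_def)
  have le: "hyp_dist z (c x) \<le> hyp_dist z (c y) \<longleftrightarrow>
     cmod (w - of_real x) / cmod (w + of_real x) \<le> cmod (w - of_real y) / cmod (w + of_real y)"
    if "x > 0" "y > 0" for x y
    using hyp_dist_le_iff[of z "c x" z "c y"] c1 that z d by simp
  have G: "diameter_geodesic \<tau> = c ` {0<..}"
    using diameter_geodesic_eq[OF \<tau>] by (simp add: c_def[abs_def])
  have "hyp_proj \<tau> z = c (cmod w)"
    unfolding hyp_proj_def G
  proof (rule the_equality)
    show "c (cmod w) \<in> c ` {0<..} \<and> (\<forall>q\<in>c ` {0<..}. hyp_dist z (c (cmod w)) \<le> hyp_dist z q)"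
      using w0 le norm_closest_real_point(1)[OF w] by auto
  next
    fix p assume p: "p \<in> c ` {0<..} \<and> (\<forall>q\<in>c ` {0<..}. hyp_dist z p \<le> hyp_dist z q)"
    then obtain x where x: "x > 0" "p = c x" by auto
    then have "hyp_dist z (c x) \<le> hyp_dist z (c (cmod w))" using p w0 by auto
    then show "p = c (cmod w)"
      using le[of x "cmod w"] x w0 norm_closest_real_point(2)[OF w, of x] by auto
  qed
  then show ?thesis by (simp add: c_def w_def)
qed

lemma orthogonal_speed_eq:
  assumes \<phi>: "disc_semigroup \<phi>" and h: "koenigs_function \<phi> h" and t: "t \<ge> 0"
  shows "orthogonal_speed \<phi> t = \<bar>ln (cmod (cayley (denjoy_wolff_point \<phi>) (\<phi> t 0)))\<bar> / 2"
proof -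
  define \<tau> where "\<tau> = denjoy_wolff_point \<phi>"
  have \<tau>: "cmod \<tau> = 1" using denjoy_wolff(1)[OF \<phi> h] by (simp add: \<tau>_def)
  have z: "cmod (\<phi> t 0) < 1" using disc_semigroupD(3)[OF \<phi> t, of 0] by simp
  define a where "a = cmod (cayley \<tau> (\<phi> t 0))"
  have a: "a > 0" using Re_cayley_pos[OF \<tau> z] by (auto simp: a_def)
  let ?p = "cayley_inv \<tau> (of_real a)"
  have "orthogonal_speed \<phi> t = artanh (pdist 0 ?p)"
    using hyp_proj_eq[OF \<tau> z] by (simp add: orthogonal_speed_def hyp_dist_eq_artanh_pdist \<tau>_def a_def)
  also have "pdist 0 ?p = cmod (1 - of_real a) / cmod (1 + of_real a)"
  proof -
    have "\<tau> \<noteq> 0" using \<tau> by auto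
    then have "cayley \<tau> 0 = 1" by (simp add: cayley_def)
    then show ?thesis
      using pdist_cayley[OF \<tau>, of 0 ?p] cayley_inv_in_disc[OF \<tau>, of "of_real a"]
        cayley_cayley_inv[OF \<tau>, of "of_real a"] a by simp
  qed
  also have "\<dots> = \<bar>1 - a\<bar> / (1 + a)"
    using a norm_of_real[of "1 - a", where 'a = complex] norm_of_real[of "1 + a", where 'a = complex]
    by (simp del: norm_of_real)
  also have "artanh \<dots> = \<bar>ln a\<bar> / 2"
  proof (cases "a \<ge> 1")
    case True
    then have "(1 + \<bar>1 - a\<bar> / (1 + a)) / (1 - \<bar>1 - a\<bar> / (1 + a)) = a"
      by (simp add: field_simps)
    then show ?thesis using True by (simp add: artanh_def)
  next
    case False
    have "1 + \<bar>1 - a\<bar> / (1 + a) = 2 / (1 + a)" "1 - \<bar>1 - a\<bar> / (1 + a) = 2 * a / (1 + a)"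
      using False a by (simp_all add: field_simps)
    then have "(1 + \<bar>1 - a\<bar> / (1 + a)) / (1 - \<bar>1 - a\<bar> / (1 + a)) = 1 / a"
      using a by (simp add: divide_divide_times_eq) (simp add: field_simps add_pos_pos less_imp_neq[symmetric])
    then show ?thesis using False a by (simp add: artanh_def ln_div)
  qed
  finally show ?thesis by (simp add: a_def \<tau>_def)
qed

section \<open>A length-area inequality for univalent functions\<close>

text \<open>The disc lives in \<open>real^2\<close> rather than in \<open>complex\<close> because the areas below come from the
  change of variables formula for Cartesian powers of the reals.\<close>

definition disc_area :: real where
  "disc_area = measure lebesgue (cball (0::real^2) 1)"

lemma integral_vec2_eq_iterated:
  fixes f :: "real^2 \<Rightarrow> real"
  assumes f: "continuous_on (cbox (vector [a, c]) (vector [b, d])) f"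
  shows "integral (cbox (vector [a, c]) (vector [b, d])) f
       = integral {a..b} (\<lambda>x. integral {c..d} (\<lambda>y. f (vector [x, y])))"
proof -
  define g :: "real \<times> real \<Rightarrow> real^2" where "g p = vector [fst p, snd p]" for p
  define g' :: "real^2 \<Rightarrow> real \<times> real" where "g' v = (v $ 1, v $ 2)" for v
  have inv: "g' (g p) = p" "g (g' v) = v" for p v
    by (simp_all add: g_def g'_def vec_eq_iff forall_2)
  have g_cbox: "g ` cbox u v = cbox (g u) (g v)" for u v
  proof (intro equalityI subsetI)
    fix w assume w: "w \<in> cbox (g u) (g v)"
    then have "g' w \<in> cbox u v"
      by (cases u; cases v) (simp add: g_def g'_def mem_box_cart forall_2 cbox_Pair_eq)
    then show "w \<in> g ` cbox u v"
      using inv(2) by (metis imageI)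
  qed (cases u; cases v; auto simp: g_def mem_box_cart forall_2 cbox_Pair_eq)
  then have g'_cbox: "g' ` cbox (g u) (g v) = cbox u v" for u v
    by (simp add: g_cbox[symmetric] image_image inv(1))
  have content: "measure lborel (g ` cbox u v) = measure lborel (cbox u v)" for u v
  proof -
    have "cbox u v = {} \<longleftrightarrow> cbox (g u) (g v) = {}"
      using g_cbox[of u v] by auto
    moreover have "measure lborel (cbox (g u) (g v)) = measure lborel (cbox u v)" if "cbox (g u) (g v) \<noteq> {}" "cbox u v \<noteq> {}"
    proof -
      have "measure lborel (cbox u v) = (fst v - fst u) * (snd v - snd u)"
      proof -
        have "fst u \<le> fst v" "snd u \<le> snd v"
          using that(2) by (cases u; cases v; auto simp: cbox_Pair_eq)+
        then show ?thesis
          using content_Pair[of "fst u" "snd u" "fst v" "snd v"] by simp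
      qed
      then show ?thesis
        using that(1) by (simp add: content_cbox_cart g_def UNIV_2)
    qed
    ultimately show ?thesis
      by (metis g_cbox content_empty)
  qed
  have eq: "vector [a, c] = g (a, c)" "vector [b, d] = g (b, d)"
    by (simp_all add: g_def)
  have cont_g: "continuous_on UNIV g"
    by (intro linear_continuous_on linear_conv_bounded_linear[THEN iffD1] linearI)
       (simp_all add: g_def vec_eq_iff forall_2)
  have "((\<lambda>p. f (g p)) has_integral (1 / 1) *\<^sub>R integral (cbox (g (a, c)) (g (b, d))) f)
         (g' ` cbox (g (a, c)) (g (b, d)))"
  proof (rule has_integral_twiddle)
    show "\<exists>w z. g ` cbox u v = cbox w z" for u v
      using g_cbox by blast
    show "\<exists>w z. g' ` cbox u v = cbox w z" for u v
      using g'_cbox[of "g' u" "g' v"] unfolding inv(2) by blast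
    show "(f has_integral integral (cbox (g (a, c)) (g (b, d))) f) (cbox (g (a, c)) (g (b, d)))"
      using f by (intro integrable_integral integrable_continuous) (simp add: eq)
    show "continuous (at x) g" for x
      using cont_g unfolding continuous_on_eq_continuous_at[OF open_UNIV] by (rule bspec) simp
  qed (simp_all add: inv content)
  then have "integral (cbox (g (a, c)) (g (b, d))) f = integral (cbox (a, c) (b, d)) (\<lambda>p. f (g p))"
    by (simp add: g'_cbox integral_unique)
  also have "\<dots> = integral (cbox a b) (\<lambda>x. integral (cbox c d) (\<lambda>y. f (g (x, y))))"
  proof (rule integral_prod_continuous)
    show "continuous_on (cbox (a, c) (b, d)) (\<lambda>p. f (g p))"
      by (rule continuous_on_compose2[OF f continuous_on_subset[OF cont_g]]) (use g_cbox eq in auto)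
  qed
  finally show ?thesis
    by (simp add: g_def)
qed

text \<open>The Jacobian determinant of \<open>k\<close> is \<open>\<bar>k'\<bar>\<^sup>2\<close>, so for injective \<open>k\<close> the integral is the area of
  the image of the rectangle, which is contained in the unit disc.\<close>

lemma area_univalent_le:
  assumes U: "open U" and k: "k holomorphic_on U" "inj_on k U"
    and rect: "\<And>x y. a \<le> x \<Longrightarrow> x \<le> b \<Longrightarrow> c \<le> y \<Longrightarrow> y \<le> d \<Longrightarrow> Complex x y \<in> U"
    and bound: "\<And>z. z \<in> U \<Longrightarrow> cmod (k z) \<le> 1"
  shows "integral {a..b} (\<lambda>x. integral {c..d} (\<lambda>y. (cmod (deriv k (Complex x y)))\<^sup>2)) \<le> disc_area"
proof -
  define p :: "real^2 \<Rightarrow> complex" where "p v = Complex (v $ 1) (v $ 2)" for v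
  define q :: "complex \<Rightarrow> real^2" where "q z = vector [Re z, Im z]" for z
  define S :: "(real^2) set" where "S = cbox (vector [a, c]) (vector [b, d])"
  have pU: "p v \<in> U" if "v \<in> S" for v
    using that rect by (simp add: p_def S_def mem_box_cart forall_2)
  have p_inj: "inj p"
    by (rule injI) (simp add: p_def vec_eq_iff forall_2)
  have q_inj: "inj q"
    by (rule injI) (simp add: q_def vec_eq_iff forall_2 complex_eq_iff)
  have p_lin: "bounded_linear p"
    by (intro linear_conv_bounded_linear[THEN iffD1] linearI) (simp_all add: p_def complex_eq_iff)
  have q_lin: "bounded_linear q"
    by (intro linear_conv_bounded_linear[THEN iffD1] linearI)
       (simp_all add: q_def vec_eq_iff forall_2)
  have norm_q: "norm (q z) = cmod z" for z
    by (simp add: q_def norm_vec_def L2_set_def sum_2 cmod_def)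
  define F where "F v = q (k (p v))" for v
  define F' where "F' v u = q (deriv k (p v) * p u)" for v u
  have der: "(F has_derivative F' v) (at v within S)" if "v \<in> S" for v
  proof -
    have "(k has_field_derivative deriv k (p v)) (at (p v))"
      using holomorphic_derivI[OF k(1) U pU[OF that]] .
    then have "(k has_derivative (\<lambda>w. deriv k (p v) * w)) (at (p v))"
      by (simp add: has_field_derivative_def)
    then have "((\<lambda>v. k (p v)) has_derivative (\<lambda>u. deriv k (p v) * p u)) (at v within S)"
      by (rule has_derivative_compose[OF bounded_linear.has_derivative[OF p_lin has_derivative_ident]])
    then show ?thesis
      unfolding F_def F'_def by (rule bounded_linear.has_derivative[OF q_lin])
  qed
  have det: "det (matrix (F' v)) = (cmod (deriv k (p v)))\<^sup>2" for v
    unfolding cmod_power2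
    by (simp add: det_2 matrix_def F'_def q_def p_def axis_def power2_eq_square)
  have inj: "inj_on F S"
  proof (rule inj_onI)
    fix v w assume "v \<in> S" "w \<in> S" "F v = F w"
    then show "v = w"
      using inj_onD[OF k(2), of "p v" "p w"] injD[OF p_inj] injD[OF q_inj] pU by (auto simp: F_def)
  qed
  have cont: "continuous_on S (\<lambda>v. (cmod (deriv k (p v)))\<^sup>2)"
    by (intro continuous_intros continuous_on_compose2[OF holomorphic_on_imp_continuous_on[OF holomorphic_deriv[OF k(1) U]]]
        linear_continuous_on p_lin) (use pU in auto)
  have S: "S \<in> sets lebesgue" by (simp add: S_def)
  have int: "(\<lambda>v. \<bar>det (matrix (F' v))\<bar>) integrable_on S"
    using cont by (simp add: det S_def integrable_continuous)
  have "integral S (\<lambda>v. (cmod (deriv k (p v)))\<^sup>2) = measure lebesgue (F ` S)"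
    using measure_differentiable_image_eq[OF S der inj int] by (simp add: det)
  also have "\<dots> \<le> disc_area"
    unfolding disc_area_def
  proof (rule measure_mono_fmeasurable)
    show "F ` S \<subseteq> cball 0 1"
      using bound pU by (auto simp: F_def norm_q)
    show "F ` S \<in> sets lebesgue"
      using measurable_differentiable_image_eq[OF S der inj] int by (simp add: fmeasurable_def)
  qed simp
  also have "integral S (\<lambda>v. (cmod (deriv k (p v)))\<^sup>2)
     = integral {a..b} (\<lambda>x. integral {c..d} (\<lambda>y. (cmod (deriv k (p (vector [x, y]))))\<^sup>2))"
    using cont unfolding S_def by (rule integral_vec2_eq_iterated)
  finally show ?thesis
    by (simp add: p_def)
qed

text \<open>The length of the path is at least \<open>d\<close>, and the Cauchy--Schwarz inequality on an interval of
  length \<open>2 Y\<close> bounds the square of the length by \<open>2 Y\<close> times the energy.\<close>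

lemma energy_lower_bound:
  fixes f :: "real \<Rightarrow> complex"
  assumes f: "\<And>y. -Y \<le> y \<Longrightarrow> y \<le> Y \<Longrightarrow> (f has_vector_derivative f' y) (at y)"
    and cont: "continuous_on {-Y..Y} f'"
    and u: "-Y \<le> u" "u \<le> v" "v \<le> Y" and d: "d > 0" "d \<le> cmod (f v - f u)"
  shows "d\<^sup>2 \<le> 2 * Y * integral {-Y..Y} (\<lambda>y. (cmod (f' y))\<^sup>2)"
proof -
  have "u \<noteq> v" using d by auto
  then have Y: "Y > 0" using u by auto
  \<comment> \<open>Cauchy--Schwarz in the form \<open>s \<le> e s\<^sup>2 / 2 + 1 / (2 e)\<close>, with the parameter \<open>e\<close> that makes the
    constant term integrate to \<open>d / 2\<close>.\<close>
  define e where "e = 2 * Y / d"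
  have e: "e > 0" using Y d by (simp add: e_def)
  let ?q = "\<lambda>y. e / 2 * (cmod (f' y))\<^sup>2 + 1 / (2 * e)"
  have q: "cmod (f' y) \<le> ?q y" for y
  proof -
    have "0 \<le> (e * cmod (f' y) - 1)\<^sup>2 / (2 * e)" using e by simp
    also have "\<dots> = ?q y - cmod (f' y)" using e by (simp add: field_simps power2_eq_square)
    finally show ?thesis by simp
  qed
  have q_int: "?q integrable_on {s..t}" if "-Y \<le> s" "t \<le> Y" for s t
  proof -
    have c: "continuous_on {s..t} f'"
      by (rule continuous_on_subset[OF cont]) (use that in auto)
    show ?thesis
      by (rule integrable_continuous_interval) (intro continuous_intros c)
  qed
  have "(f' has_integral f v - f u) {u..v}"
  proof (rule fundamental_theorem_of_calculus[OF u(2)])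
    fix y assume "y \<in> {u..v}"
    then show "(f has_vector_derivative f' y) (at y within {u..v})"
      using f[of y] u by (auto intro: has_vector_derivative_at_within)
  qed
  then have "cmod (f v - f u) \<le> integral {u..v} ?q"
    using integral_norm_bound_integral[of f' "{u..v}" ?q] q_int[of u v] q u
    by (simp add: has_integral_iff)
  also have "\<dots> \<le> integral {-Y..Y} ?q"
    using u e by (intro integral_subset_le q_int) auto
  also have "\<dots> = e / 2 * integral {-Y..Y} (\<lambda>y. (cmod (f' y))\<^sup>2) + 2 * Y / (2 * e)"
  proof -
    have "integral {-Y..Y} ?q = integral {-Y..Y} (\<lambda>y. e / 2 * (cmod (f' y))\<^sup>2) + integral {-Y..Y} (\<lambda>y. 1 / (2 * e))"
      by (intro integral_add integrable_continuous_interval continuous_intros cont)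
    then show ?thesis using Y by simp
  qed
  finally have "d \<le> Y / d * integral {-Y..Y} (\<lambda>y. (cmod (f' y))\<^sup>2) + d / 2"
    using d Y by (simp add: e_def)
  then show ?thesis
    using d by (simp add: field_simps power2_eq_square)
qed

text \<open>If \<open>k\<close> oscillates by at least \<open>d\<close> on every vertical segment of the rectangle, each segment
  carries energy at least \<open>d\<^sup>2 / (2 Y)\<close>. The total energy is the area of the image, at most
  that of the unit disc, so the rectangle cannot be long.\<close>

theorem length_area_univalent:
  assumes U: "open U" and k: "k holomorphic_on U" "inj_on k U"
    and bound: "\<And>z. z \<in> U \<Longrightarrow> cmod (k z) \<le> 1"
    and rect: "\<And>x y. a \<le> x \<Longrightarrow> x \<le> b \<Longrightarrow> \<bar>y\<bar> \<le> Y \<Longrightarrow> Complex x y \<in> U"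
    and ab: "a \<le> b" and d: "d > 0"
    and osc: "\<And>x. a \<le> x \<Longrightarrow> x \<le> b \<Longrightarrow> \<exists>y. \<bar>y\<bar> \<le> Y \<and> d \<le> cmod (k (Complex x y) - k (of_real x))"
  shows "(b - a) * d\<^sup>2 \<le> 2 * Y * disc_area"
proof -
  have Y: "Y \<ge> 0" using osc[of a] ab by force
  let ?J = "\<lambda>x. integral {-Y..Y} (\<lambda>y. (cmod (deriv k (Complex x y)))\<^sup>2)"
  have k': "continuous_on U (deriv k)"
    by (intro holomorphic_on_imp_continuous_on holomorphic_deriv k U)
  have Complex_eq: "Complex x y = of_real x + \<i> * of_real y" for x y
    by (simp add: complex_eq_iff)
  have J: "d\<^sup>2 \<le> 2 * Y * ?J x" if x: "a \<le> x" "x \<le> b" for x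
  proof -
    obtain y where y: "\<bar>y\<bar> \<le> Y" "d \<le> cmod (k (Complex x y) - k (of_real x))"
      using osc x by blast
    define f where "f t = k (Complex x t)" for t
    define f' where "f' t = \<i> * deriv k (Complex x t)" for t
    have der: "(f has_vector_derivative f' t) (at t)" if "-Y \<le> t" "t \<le> Y" for t
    proof -
      have "(Complex x has_vector_derivative \<i>) (at t)"
        unfolding Complex_eq[abs_def] by (auto intro!: derivative_eq_intros)
      moreover have "(k has_field_derivative deriv k (Complex x t)) (at (Complex x t))"
        using holomorphic_derivI[OF k(1) U rect[of x t]] x that by auto
      ultimately show ?thesis
        using field_vector_diff_chain_at[of "Complex x" \<i> t k "deriv k (Complex x t)"]
        by (simp add: f_def[abs_def] f'_def o_def)
    qed
    have cont: "continuous_on {-Y..Y} f'"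
      unfolding f'_def Complex_eq
      by (intro continuous_intros continuous_on_compose2[OF k']) (use rect x in \<open>auto simp flip: Complex_eq\<close>)
    have f0: "f 0 = k (of_real x)" by (simp add: f_def Complex_eq)
    have "d\<^sup>2 \<le> 2 * Y * integral {-Y..Y} (\<lambda>y. (cmod (f' y))\<^sup>2)"
    proof (cases "y \<ge> 0")
      case True
      then show ?thesis
        using y f0 by (intro energy_lower_bound[OF der cont _ _ _ d, where u = 0 and v = y]) (auto simp: f_def)
    next
      case False
      then show ?thesis
        using y f0 by (intro energy_lower_bound[OF der cont _ _ _ d, where u = y and v = 0])
          (auto simp: f_def norm_minus_commute)
    qed
    then show ?thesis by (simp add: f'_def norm_mult)
  qed
  have contJ: "continuous_on {a..b} ?J"
  proof -
    have "continuous_on ({a..b} \<times> cbox (-Y) Y) (\<lambda>(x, y). (cmod (deriv k (Complex x y)))\<^sup>2)"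
      unfolding Complex_eq case_prod_beta
      by (intro continuous_intros continuous_on_compose2[OF k']) (use rect in \<open>auto simp flip: Complex_eq\<close>)
    from integral_continuous_on_param[OF this] show ?thesis by simp
  qed
  have "(b - a) * d\<^sup>2 = integral {a..b} (\<lambda>x. d\<^sup>2)"
    using ab by simp
  also have "\<dots> \<le> integral {a..b} (\<lambda>x. 2 * Y * ?J x)"
    by (intro integral_le integrable_continuous_interval continuous_intros contJ) (use J in auto)
  also have "\<dots> = 2 * Y * integral {a..b} ?J"
    by simp
  also have "\<dots> \<le> 2 * Y * disc_area"
    by (intro mult_left_mono area_univalent_le[OF U k _ bound]) (use rect Y in auto)
  finally show ?thesis .
qed

section \<open>Escaping curves under univalent self-maps of the half-plane\<close>

text \<open>In the logarithmic coordinate the half-circles of the half-plane become the vertical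
  segments of the strip \<open>\<bar>Im z\<bar> < \<pi> / 2\<close>. There \<open>k = R / (F \<circ> exp + R)\<close> is univalent and bounded
  by \<open>1\<close>. It is within \<open>1 / 3\<close> of \<open>1\<close> at the real points \<open>x \<ge> 0\<close> with \<open>C e\<^sup>x \<le> R / 3\<close>, and at
  distance at least \<open>1 / 2\<close> from \<open>1\<close> on the logarithm of the curve. The width of the strip does
  not depend on \<open>w\<close>, hence neither does the constant.\<close>

theorem escaping_curve_bound:
  fixes F :: "complex \<Rightarrow> complex" and w :: "real \<Rightarrow> complex"
  assumes F: "F holomorphic_on {z. Re z > 0}" "inj_on F {z. Re z > 0}"
    and F_pos: "\<And>z. Re z > 0 \<Longrightarrow> Re (F z) > 0"
    and C: "C > 0" "\<And>x. x \<ge> 1 \<Longrightarrow> cmod (F (of_real x)) \<le> C * x"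
    and w: "continuous_on {t..} w" "\<And>s. s \<ge> t \<Longrightarrow> Re (w s) > 0"
    and w_lim: "filterlim (\<lambda>s. cmod (w s)) at_top at_top"
    and w1: "cmod (w t) \<ge> 1"
    and R: "\<And>s. s \<ge> t \<Longrightarrow> R \<le> cmod (F (w s))" and R0: "R > 0"
  shows "R \<le> 3 * C * exp (36 * pi * disc_area) * cmod (w t)"
proof -
  define a where "a = ln (cmod (w t))"
  define b where "b = ln (R / (3 * C))"
  have area: "disc_area \<ge> 0" by (simp add: disc_area_def)
  have exp_a: "exp a = cmod (w t)" unfolding a_def by (rule exp_ln) (use w1 in linarith)
  have exp_b: "exp b = R / (3 * C)" using R0 C(1) by (simp add: b_def)
  have a0: "a \<ge> 0" using w1 by (simp add: a_def)
  have "b - a \<le> 36 * pi * disc_area"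
  proof (cases "b \<le> a")
    case True
    then show ?thesis using area by (smt (verit) mult_nonneg_nonneg pi_ge_zero)
  next
    case False
    have "eventually (\<lambda>s. exp b \<le> cmod (w s) \<and> t \<le> s) at_top"
      using w_lim eventually_ge_at_top[of t] by (auto simp: filterlim_at_top eventually_conj_iff)
    then obtain t2 where t2: "t \<le> t2" "exp b \<le> cmod (w t2)"
      using eventually_happens[of _ "at_top :: real filter"] by auto
    have w_cont: "continuous_on {t..t2} w"
      by (rule continuous_on_subset[OF w(1)]) auto
    have w_slit: "w s \<notin> \<real>\<^sub>\<le>\<^sub>0" if "s \<ge> t" for s
      using w(2)[OF that] by (auto simp: complex_nonpos_Reals_iff)
    have Ln_cont: "continuous_on {t..t2} (\<lambda>s. \<bar>Im (Ln (w s))\<bar>)"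
      by (intro continuous_intros w_cont) (use w_slit in auto)
    \<comment> \<open>By compactness the relevant part of the curve stays in a rectangle strictly inside the strip,
      so the energy integrals involve only continuous functions.\<close>
    obtain s0 where s0: "s0 \<in> {t..t2}" "\<And>s. s \<in> {t..t2} \<Longrightarrow> \<bar>Im (Ln (w s))\<bar> \<le> \<bar>Im (Ln (w s0))\<bar>"
      using continuous_attains_sup[OF _ _ Ln_cont] t2(1) by auto
    define Y where "Y = \<bar>Im (Ln (w s0))\<bar>"
    have Y: "Y < pi / 2"
    proof -
      have "Re (w s0) > 0" using w(2) s0(1) by simp
      moreover from this have "w s0 \<noteq> 0" by auto
      ultimately show ?thesis
        unfolding Y_def using Re_Ln_pos_lt by blast
    qed
    define U where "U = {z. \<bar>Im z\<bar> < pi / 2}"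
    have exp_U: "Re (exp z) > 0" if "z \<in> U" for z
    proof -
      have "cos (Im z) > 0"
        using that by (intro cos_gt_zero_pi) (auto simp: U_def abs_less_iff)
      then show ?thesis by (simp add: Re_exp)
    qed
    have denom: "cmod (F z + of_real R) \<ge> R" "F z + of_real R \<noteq> 0" if "Re z > 0" for z
    proof -
      have "Re (F z + of_real R) > R" using F_pos[OF that] by simp
      then show "cmod (F z + of_real R) \<ge> R" "F z + of_real R \<noteq> 0"
        using complex_Re_le_cmod[of "F z + of_real R"] R0 by (linarith, force)
    qed
    define k where "k z = of_real R / (F (exp z) + of_real R)" for z
    have "(b - a) * (1 / 6)\<^sup>2 \<le> 2 * Y * disc_area"
    proof (rule length_area_univalent[of U k])
      show "open U"
        unfolding U_def by (intro open_Collect_less continuous_intros)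
      have "F \<circ> exp holomorphic_on U"
        by (rule holomorphic_on_compose_gen[OF _ F(1)]) (use exp_U in \<open>auto intro!: holomorphic_intros\<close>)
      then have "(\<lambda>z. F (exp z)) holomorphic_on U" by (simp add: o_def)
      then show "k holomorphic_on U"
        unfolding k_def using denom(2) exp_U by (intro holomorphic_intros) auto
      show "inj_on k U"
      proof (rule inj_onI)
        fix z z' assume z: "z \<in> U" "z' \<in> U" and "k z = k z'"
        then have "F (exp z) = F (exp z')"
          using R0 denom(2) exp_U by (simp add: k_def field_simps)
        then have "exp z = exp z'"
          using inj_onD[OF F(2)] exp_U z by auto
        moreover have "Ln (exp v) = v" if "v \<in> U" for v
          using that by (intro Ln_exp) (auto simp: U_def abs_less_iff)
        ultimately show "z = z'" using z by metis
      qed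
      show "cmod (k z) \<le> 1" if "z \<in> U" for z
        using denom[OF exp_U[OF that]] R0 by (simp add: k_def norm_divide)
      show "Complex x y \<in> U" if "\<bar>y\<bar> \<le> Y" for x y
        using that Y by (simp add: U_def)
      show "\<exists>y. \<bar>y\<bar> \<le> Y \<and> 1 / 6 \<le> cmod (k (Complex x y) - k (of_real x))" if x: "a \<le> x" "x \<le> b" for x
      proof -
        have "cmod (w t) \<le> exp x" "exp x \<le> cmod (w t2)"
          using x exp_a t2(2) by (metis exp_le_cancel_iff) (use x t2(2) in \<open>metis exp_le_cancel_iff order_trans\<close>)
        then obtain s where s: "t \<le> s" "s \<le> t2" "cmod (w s) = exp x"
          using IVT'[of "\<lambda>s. cmod (w s)" t "exp x" t2] t2(1) continuous_on_norm[OF w_cont] by auto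
        define y where "y = Im (Ln (w s))"
        have ws: "Re (w s) > 0" "w s \<noteq> 0" using w(2)[OF s(1)] by auto
        have "Ln (w s) = Complex x y"
          using ws s(3) by (simp add: complex_eq_iff y_def Re_Ln)
        then have exp_xy: "exp (Complex x y) = w s"
          using ws by (metis exp_Ln)
        have far: "cmod (k (Complex x y) - 1) \<ge> 1 / 2"
        proof -
          let ?v = "F (w s)"
          have "k (Complex x y) - 1 = - ?v / (?v + of_real R)"
            using denom(2)[OF ws(1)] by (simp add: k_def exp_xy field_simps)
          then have eq: "cmod (k (Complex x y) - 1) = cmod ?v / cmod (?v + of_real R)"
            by (simp add: norm_divide)
          have "cmod (?v + of_real R) \<le> 2 * cmod ?v"
            using norm_triangle_ineq[of ?v "of_real R"] R[OF s(1)] R0 by simp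
          moreover have "cmod (?v + of_real R) > 0"
            using denom(2)[OF ws(1)] by simp
          ultimately show ?thesis
            unfolding eq by (simp add: pos_le_divide_eq)
        qed
        have near: "cmod (k (of_real x) - 1) \<le> 1 / 3"
        proof -
          let ?v = "F (of_real (exp x))"
          have ex: "exp x \<ge> 1" using x a0 by simp
          have "cmod ?v \<le> C * exp x" using C(2)[OF ex] .
          also have "\<dots> \<le> C * exp b" using x C(1) by simp
          also have "\<dots> = R / 3" using exp_b C(1) by simp
          finally have v: "cmod ?v \<le> R / 3" .
          have d: "cmod (?v + of_real R) \<ge> R" "?v + of_real R \<noteq> 0"
            using denom[of "of_real (exp x)"] by auto
          have "k (of_real x) - 1 = - ?v / (?v + of_real R)"
            using d(2) by (simp add: k_def exp_of_real field_simps)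
          then have "cmod (k (of_real x) - 1) = cmod ?v / cmod (?v + of_real R)"
            by (simp add: norm_divide)
          also have "\<dots> \<le> (R / 3) / R"
            using v d R0 by (intro frac_le) auto
          finally show ?thesis using R0 by simp
        qed
        have "1 / 6 \<le> cmod (k (Complex x y) - k (of_real x))"
          using norm_triangle_ineq4[of "k (Complex x y) - k (of_real x)" "1 - k (of_real x)"] far near
          by (simp add: norm_minus_commute algebra_simps)
        moreover have "\<bar>y\<bar> \<le> Y"
          using s0(2)[of s] s by (simp add: y_def Y_def)
        ultimately show ?thesis by blast
      qed
    qed (use False in auto)
    also have "\<dots> \<le> pi * disc_area"
      using Y area by (intro mult_right_mono) auto
    finally show ?thesis by (simp add: power2_eq_square)
  qed
  then have "exp b \<le> exp (a + 36 * pi * disc_area)" by simp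
  then have "R / (3 * C) \<le> cmod (w t) * exp (36 * pi * disc_area)"
    by (simp only: exp_add exp_a exp_b)
  then show ?thesis using C(1) by (simp add: field_simps)
qed

section \<open>Size and monotonicity of orbits in the half-plane coordinate\<close>

lemma one_minus_norm_sq_cayley:
  assumes \<tau>: "cmod \<tau> = 1" and z: "cmod z < 1"
  shows "1 - (cmod z)\<^sup>2 = 4 * Re (cayley \<tau> z) / (cmod (cayley \<tau> z + 1))\<^sup>2"
proof -
  have nz: "\<tau> - z \<noteq> 0" using z \<tau> by auto
  then have "cayley \<tau> z + 1 = 2 * \<tau> / (\<tau> - z)"
    by (simp add: cayley_def field_simps)
  then have "(cmod (cayley \<tau> z + 1))\<^sup>2 = 4 / (cmod (\<tau> - z))\<^sup>2"
    using \<tau> by (simp add: norm_divide norm_mult power_divide)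
  then show ?thesis using nz by (simp add: Re_cayley[OF \<tau>])
qed

text \<open>The Schwarz--Pick lemma gives \<open>1 - \<bar>f z\<bar>\<^sup>2 \<ge> (1 - \<bar>z\<bar>\<^sup>2) / C\<close> with a constant depending on \<open>f 0\<close>,
  and \<open>\<bar>cayley \<sigma> v\<bar> \<le> 2 / (1 - \<bar>v\<bar>)\<close>. On sectors
  \<open>\<bar>w\<bar> \<le> M Re w\<close>, in particular on the positive axis, the bound is linear in \<open>\<bar>w\<bar>\<close> away from \<open>0\<close>.\<close>

lemma cayley_growth:
  assumes f: "f holomorphic_on unit_disc" "f ` unit_disc \<subseteq> unit_disc"
    and \<tau>: "cmod \<tau> = 1" and \<sigma>: "cmod \<sigma> = 1"
  obtains C where "C > 0"
    "\<And>z. cmod z < 1 \<Longrightarrow> cmod (cayley \<sigma> (f z)) \<le> C * ((cmod (cayley \<tau> z + 1))\<^sup>2 / Re (cayley \<tau> z))"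
proof -
  have fD: "cmod (f z) < 1" if "cmod z < 1" for z
    using subsetD[OF f(2) imageI[of z]] that by auto
  define r where "r = cmod (f 0)"
  have r: "0 \<le> r" "r < 1" using fD[of 0] by (auto simp: r_def)
  define C where "C = (1 + r) / (1 - r)"
  have C: "C > 0" using r by (simp add: C_def)
  have "cmod (cayley \<sigma> (f z)) \<le> C * ((cmod (cayley \<tau> z + 1))\<^sup>2 / Re (cayley \<tau> z))" if z: "cmod z < 1" for z
  proof -
    define v where "v = f z"
    have v: "cmod v < 1" using fD[OF z] by (simp add: v_def)
    have z2: "1 - (cmod z)\<^sup>2 > 0" and v2: "1 - (cmod v)\<^sup>2 > 0"
      using z v by (simp_all add: abs_square_less_1)
    have "pdist v (f 0) \<le> pdist z 0"
      unfolding v_def by (rule schwarz_pick[OF f]) (use z in auto)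
    then have "(pdist v (f 0))\<^sup>2 \<le> (cmod z)\<^sup>2"
      by (simp add: pdist_def Moebius_function_simple power_mono)
    moreover have nz: "cmod (1 - cnj (f 0) * v) > 0"
      using one_minus_cnj_mult_nonzero[of v "f 0"] v fD[of 0] by auto
    ultimately have "(cmod (v - f 0))\<^sup>2 \<le> (cmod z)\<^sup>2 * (cmod (1 - cnj (f 0) * v))\<^sup>2"
      by (simp add: pdist_def Moebius_function_simple norm_divide power_divide pos_divide_le_eq)
    then have "(1 - (cmod z)\<^sup>2) * (cmod (1 - cnj (f 0) * v))\<^sup>2 \<le> (1 - (cmod v)\<^sup>2) * (1 - r\<^sup>2)"
      using norm_one_minus_cnj_mult_sq[of "f 0" v] by (simp add: r_def algebra_simps)
    moreover have "1 - r \<le> cmod (1 - cnj (f 0) * v)"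
    proof -
      have "cmod (cnj (f 0) * v) \<le> r * 1"
        unfolding norm_mult using v r by (intro mult_mono) (auto simp: r_def)
      then show ?thesis
        using norm_triangle_ineq2[of 1 "cnj (f 0) * v"] by simp
    qed
    then have "(1 - r)\<^sup>2 \<le> (cmod (1 - cnj (f 0) * v))\<^sup>2"
      using r by (intro power_mono) auto
    then have "(1 - (cmod z)\<^sup>2) * (1 - r)\<^sup>2 \<le> (1 - (cmod z)\<^sup>2) * (cmod (1 - cnj (f 0) * v))\<^sup>2"
      using z2 by (intro mult_left_mono) auto
    ultimately have "(1 - (cmod z)\<^sup>2) * (1 - r)\<^sup>2 \<le> (1 - (cmod v)\<^sup>2) * (1 - r\<^sup>2)"
      by linarith
    then have "(1 - r) * ((1 - (cmod z)\<^sup>2) * (1 - r)) \<le> (1 - r) * ((1 - (cmod v)\<^sup>2) * (1 + r))"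
      by (simp add: power2_eq_square algebra_simps)
    then have "(1 - (cmod z)\<^sup>2) * (1 - r) \<le> (1 - (cmod v)\<^sup>2) * (1 + r)"
      using r by (simp only: mult_le_cancel_left_pos)
    moreover have "4 / B \<le> C * (4 / A)" if "A * (1 - r) \<le> B * (1 + r)" "A > 0" "B > 0" for A B
      using that r by (simp add: C_def field_simps)
    ultimately have le: "4 / (1 - (cmod v)\<^sup>2) \<le> C * (4 / (1 - (cmod z)\<^sup>2))"
      using z2 v2 by blast
    have "cmod (cayley \<sigma> v) \<le> 2 / (1 - cmod v)"
      unfolding cayley_def norm_divide
      using norm_triangle_ineq[of \<sigma> v] norm_triangle_ineq2[of \<sigma> v] \<sigma> v by (intro frac_le) auto
    also have "\<dots> \<le> 4 / (1 - (cmod v)\<^sup>2)"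
    proof -
      have "2 * (1 - (cmod v)\<^sup>2) \<le> 4 * (1 - cmod v)"
        using zero_le_power2[of "1 - cmod v"] by (simp add: power2_eq_square algebra_simps)
      then show ?thesis using v v2 by (simp add: divide_le_eq le_divide_eq field_simps)
    qed
    also note le
    also have "4 / (1 - (cmod z)\<^sup>2) = (cmod (cayley \<tau> z + 1))\<^sup>2 / Re (cayley \<tau> z)"
      by (simp add: one_minus_norm_sq_cayley[OF \<tau> z])
    finally show ?thesis by (simp add: v_def)
  qed
  then show ?thesis using that C by blast
qed

lemma norm_cayley_le_of_pdist_le:
  assumes \<sigma>: "cmod \<sigma> = 1" and z: "cmod z < 1" "cmod w < 1" and q: "pdist z w \<le> q"
  shows "(1 - q) * cmod (cayley \<sigma> z) \<le> (1 + q) * cmod (cayley \<sigma> w)"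
proof -
  define Z where "Z = cayley \<sigma> z"
  define W where "W = cayley \<sigma> w"
  have "Re Z > 0" "Re W > 0" using Re_cayley_pos[OF \<sigma>] z by (auto simp: Z_def W_def)
  then have "cmod (Z + cnj W) > 0" by (auto simp: complex_eq_iff)
  then have "cmod (Z - W) \<le> q * cmod (Z + cnj W)"
    using q pdist_cayley[OF \<sigma> z] by (simp add: Z_def W_def pos_divide_le_eq)
  also have "\<dots> \<le> q * (cmod Z + cmod W)"
    using norm_triangle_ineq[of Z "cnj W"] order_trans[OF pdist_nonneg q] by (intro mult_left_mono) auto
  finally show ?thesis
    using norm_triangle_ineq2[of Z W] by (simp add: Z_def W_def algebra_simps)
qed

text \<open>Stolz regions at \<open>\<tau>\<close> correspond to sectors around the positive axis.\<close>

lemma nontangential_norm_cayley_le: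
  assumes \<tau>: "cmod \<tau> = 1" and z: "cmod z < 1" and M: "cmod (\<tau> - z) \<le> M * (1 - cmod z)"
  shows "cmod (cayley \<tau> z) \<le> 2 * M * Re (cayley \<tau> z)"
proof -
  have p: "cmod (\<tau> - z) > 0" using z \<tau> by auto
  then have M0: "M > 0" using M z by (smt (verit) mult_nonpos_nonneg)
  have "cmod (cayley \<tau> z) \<le> 2 / cmod (\<tau> - z)"
    unfolding cayley_def norm_divide
    using norm_triangle_ineq[of \<tau> z] \<tau> z by (intro divide_right_mono) auto
  also have "\<dots> = 2 * cmod (\<tau> - z) / (cmod (\<tau> - z))\<^sup>2"
    using p by (simp add: power2_eq_square)
  also have "\<dots> \<le> 2 * (M * (1 - (cmod z)\<^sup>2)) / (cmod (\<tau> - z))\<^sup>2"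
  proof (intro divide_right_mono mult_left_mono)
    have "(cmod z)\<^sup>2 \<le> cmod z"
      using z by (simp add: power2_eq_square mult_left_le)
    then show "cmod (\<tau> - z) \<le> M * (1 - (cmod z)\<^sup>2)"
      using M M0 by (smt (verit) mult_left_mono)
  qed auto
  finally show ?thesis by (simp add: Re_cayley[OF \<tau>])
qed

lemma orbit_cayley_at_top:
  assumes \<phi>: "disc_semigroup \<phi>" and h: "koenigs_function \<phi> h"
  shows "filterlim (\<lambda>t. cmod (cayley (denjoy_wolff_point \<phi>) (\<phi> t 0))) at_top at_top"
proof -
  define \<tau> where "\<tau> = denjoy_wolff_point \<phi>"
  have \<tau>: "cmod \<tau> = 1" and lim: "((\<lambda>t. \<phi> t 0) \<longlongrightarrow> \<tau>) at_top"
    using denjoy_wolff[OF \<phi> h] by (auto simp: \<tau>_def)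
  have num: "((\<lambda>t. cmod (\<tau> + \<phi> t 0)) \<longlongrightarrow> cmod (\<tau> + \<tau>)) at_top"
    by (intro tendsto_intros lim)
  have den: "((\<lambda>t. cmod (\<tau> - \<phi> t 0)) \<longlongrightarrow> cmod (\<tau> - \<tau>)) at_top"
    by (intro tendsto_intros lim)
  have "\<forall>\<^sub>F t in at_top. cmod (\<tau> - \<phi> t 0) > 0"
    using eventually_ge_at_top[of 0]
  proof eventually_elim
    case (elim t)
    then show ?case using disc_semigroupD(3)[OF \<phi> elim, of 0] \<tau> by auto
  qed
  then have "filterlim (\<lambda>t. inverse (cmod (\<tau> - \<phi> t 0))) at_top at_top"
    using den by (intro filterlim_inverse_at_top) auto
  moreover have "cmod (\<tau> + \<tau>) > 0" using \<tau> by auto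
  ultimately have "filterlim (\<lambda>t. cmod (\<tau> + \<phi> t 0) * inverse (cmod (\<tau> - \<phi> t 0))) at_top at_top"
    by (intro filterlim_tendsto_pos_mult_at_top[OF num])
  then show ?thesis
    unfolding cayley_def norm_divide \<tau>_def by (simp only: divide_inverse)
qed

text \<open>Always \<open>Re w\<close> is non-decreasing along the orbit. Under non-tangential convergence \<open>\<bar>w\<bar>\<close> is
  comparable to \<open>Re w\<close>. If the orthogonal speed is non-decreasing, so is \<open>\<bar>w\<bar>\<close> as soon as it
  exceeds \<open>1\<close>. If the total speed is non-decreasing, so is
  \<open>1 / (1 - \<bar>z\<bar>\<^sup>2) = \<bar>w + 1\<bar>\<^sup>2 / (4 Re w)\<close>, and hence also its product \<open>\<bar>w + 1\<bar>\<^sup>2 / 4\<close> with the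
  non-decreasing \<open>Re w\<close>.\<close>

lemma orbit_cayley_almost_nondecreasing:
  assumes \<psi>: "disc_semigroup \<psi>" and g: "koenigs_function \<psi> g"
    and alt: "nontangential_orbit \<psi> \<or> eventually_nondecreasing (orthogonal_speed \<psi>) \<or>
         eventually_nondecreasing (total_speed \<psi>)"
  defines "w \<equiv> \<lambda>t. cayley (denjoy_wolff_point \<psi>) (\<psi> t 0)"
  shows "\<exists>c>0. \<exists>t\<^sub>0\<ge>0. \<forall>t\<ge>t\<^sub>0. \<forall>s\<ge>t. c * cmod (w t) \<le> cmod (w s)"
proof -
  define \<sigma> where "\<sigma> = denjoy_wolff_point \<psi>"
  have \<sigma>: "cmod \<sigma> = 1" using denjoy_wolff(1)[OF \<psi> g] by (simp add: \<sigma>_def)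
  note S = disc_semigroupD[OF \<psi>]
  have z: "cmod (\<psi> t 0) < 1" if "t \<ge> 0" for t using S(3)[OF that, of 0] by simp
  have pos: "Re (w t) > 0" if "t \<ge> 0" for t
    using Re_cayley_pos[OF \<sigma> z[OF that]] by (simp add: w_def \<sigma>_def)
  have Re_mono: "Re (w t) \<le> Re (w s)" if "0 \<le> t" "t \<le> s" for s t
    using denjoy_wolff(3)[OF \<psi> g, of "s - t" "\<psi> t 0"] z[of t] S(5)[of "s - t" t 0] that
    by (simp add: w_def)
  have "\<forall>\<^sub>F t in at_top. cmod (w t) \<ge> 1"
    using orbit_cayley_at_top[OF \<psi> g] by (auto simp: filterlim_at_top w_def)
  then obtain T where T: "\<And>t. t \<ge> T \<Longrightarrow> cmod (w t) \<ge> 1"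
    by (auto simp: eventually_at_top_linorder)
  from alt consider "nontangential_orbit \<psi>" | "eventually_nondecreasing (orthogonal_speed \<psi>)"
    | "eventually_nondecreasing (total_speed \<psi>)" by blast
  then show ?thesis
  proof cases
    case 1
    then obtain M where "\<forall>\<^sub>F t in at_top. cmod (\<sigma> - \<psi> t 0) \<le> M * (1 - cmod (\<psi> t 0))"
      by (auto simp: nontangential_orbit_def Let_def \<sigma>_def)
    then obtain T' where T': "\<And>t. t \<ge> T' \<Longrightarrow> cmod (\<sigma> - \<psi> t 0) \<le> M * (1 - cmod (\<psi> t 0))"
      by (auto simp: eventually_at_top_linorder)
    \<comment> \<open>The constant of the Stolz region is enlarged so that it is visibly positive.\<close>
    define M' where "M' = max M 1"
    have le: "cmod (w t) \<le> 2 * M' * Re (w t)" if t: "t \<ge> max T' 0" for t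
    proof -
      have "M * (1 - cmod (\<psi> t 0)) \<le> M' * (1 - cmod (\<psi> t 0))"
        using z[of t] t by (intro mult_right_mono) (auto simp: M'_def)
      then show ?thesis
        using nontangential_norm_cayley_le[OF \<sigma> z[of t], of M'] T'[of t] t by (simp add: w_def \<sigma>_def)
    qed
    have "1 / (2 * M') * cmod (w t) \<le> cmod (w s)" if t: "t \<ge> max T' 0" "s \<ge> t" for s t
    proof -
      have "cmod (w t) \<le> 2 * M' * Re (w t)" using le t by simp
      also have "\<dots> \<le> 2 * M' * cmod (w s)"
        using Re_mono[of t s] t complex_Re_le_cmod[of "w s"] by (intro mult_left_mono) (auto simp: M'_def)
      finally show ?thesis by (simp add: M'_def field_simps)
    qed
    then show ?thesis
      by (intro exI[of _ "1 / (2 * M')"] conjI exI[of _ "max T' 0"]) (auto simp: M'_def)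
  next
    case 2
    then obtain T' where T': "T' \<ge> 0" "mono_on {T'..} (orthogonal_speed \<psi>)"
      by (auto simp: eventually_nondecreasing_def)
    have "1 * cmod (w t) \<le> cmod (w s)" if t: "t \<ge> max T' T" "s \<ge> t" for s t
    proof -
      have "orthogonal_speed \<psi> t \<le> orthogonal_speed \<psi> s"
        using mono_onD[OF T'(2)] t by auto
      moreover have "orthogonal_speed \<psi> u = ln (cmod (w u)) / 2" if "u \<ge> t" for u
        using orthogonal_speed_eq[OF \<psi> g, of u] T[of u] t T'(1) that by (simp add: w_def)
      ultimately have "ln (cmod (w t)) \<le> ln (cmod (w s))" using t by simp
      moreover have "cmod (w t) > 0" "cmod (w s) > 0"
        using T[of t] T[of s] t by linarith+
      ultimately show ?thesis by simp
    qed
    then show ?thesis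
      using T'(1) by (intro exI[of _ 1] conjI exI[of _ "max T' T"]) auto
  next
    case 3
    then obtain T' where T': "T' \<ge> 0" "mono_on {T'..} (total_speed \<psi>)"
      by (auto simp: eventually_nondecreasing_def)
    have "1 / 2 * cmod (w t) \<le> cmod (w s)" if t: "t \<ge> max T' T" "s \<ge> t" for s t
    proof -
      have t0: "t \<ge> 0" "s \<ge> 0" using t T'(1) by auto
      have "total_speed \<psi> t \<le> total_speed \<psi> s"
        using mono_onD[OF T'(2)] t by auto
      then have "pdist 0 (\<psi> t 0) \<le> pdist 0 (\<psi> s 0)"
        using hyp_dist_le_iff[of 0 "\<psi> t 0" 0 "\<psi> s 0"] z t0 by (simp add: total_speed_def)
      then have "cmod (\<psi> t 0) \<le> cmod (\<psi> s 0)"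
        by (simp add: pdist_def Moebius_function_simple)
      then have "1 - (cmod (\<psi> s 0))\<^sup>2 \<le> 1 - (cmod (\<psi> t 0))\<^sup>2"
        by (simp add: power_mono)
      then have le: "4 * Re (w s) / (cmod (w s + 1))\<^sup>2 \<le> 4 * Re (w t) / (cmod (w t + 1))\<^sup>2"
        using one_minus_norm_sq_cayley[OF \<sigma> z[OF t0(1)]] one_minus_norm_sq_cayley[OF \<sigma> z[OF t0(2)]]
        by (simp add: w_def \<sigma>_def)
      have nz: "cmod (w s + 1) > 0" "cmod (w t + 1) > 0"
        using pos[OF t0(1)] pos[OF t0(2)] by (auto simp: complex_eq_iff)
      have "Re (w t) * (cmod (w t + 1))\<^sup>2 \<le> Re (w s) * (cmod (w t + 1))\<^sup>2"
        using Re_mono[OF t0(1) t(2)] by (intro mult_right_mono) auto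
      also have "\<dots> \<le> Re (w t) * (cmod (w s + 1))\<^sup>2"
        using le nz by (simp add: field_simps)
      finally have "(cmod (w t + 1))\<^sup>2 \<le> (cmod (w s + 1))\<^sup>2"
        using pos[OF t0(1)] by simp
      then have "cmod (w t + 1) \<le> cmod (w s + 1)"
        by (rule power2_le_imp_le) simp
      moreover have "cmod (w t) \<le> cmod (w t + 1)"
      proof (rule power2_le_imp_le)
        show "(cmod (w t))\<^sup>2 \<le> (cmod (w t + 1))\<^sup>2"
          unfolding cmod_power2 using pos[OF t0(1)] by (simp add: power2_eq_square algebra_simps)
      qed simp
      moreover have "cmod (w s + 1) \<le> 2 * cmod (w s)"
        using norm_triangle_ineq[of "w s" 1] T[of s] t by simp
      ultimately show ?thesis by simp
    qed
    then show ?thesis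
      using T'(1) by (intro exI[of _ "1 / 2"] conjI exI[of _ "max T' T"]) auto
  qed
qed

section \<open>Comparison of two semigroups\<close>

text \<open>Both Koenigs functions turn the semigroups into the same vertical translation, so
  \<open>g\<inverse> \<circ> h\<close> intertwines them.\<close>

lemma koenigs_transfer:
  assumes \<phi>: "disc_semigroup \<phi>" and \<psi>: "disc_semigroup \<psi>"
    and h: "koenigs_function \<phi> h" and g: "koenigs_function \<psi> g"
    and sub: "h ` unit_disc \<subseteq> g ` unit_disc"
  obtains f where "f holomorphic_on unit_disc" "f ` unit_disc \<subseteq> unit_disc" "inj_on f unit_disc"
    "\<And>t z. t \<ge> 0 \<Longrightarrow> cmod z < 1 \<Longrightarrow> f (\<phi> t z) = \<psi> t (f z)"
proof -
  obtain g' where g': "g' holomorphic_on g ` unit_disc" "\<And>z. z \<in> unit_disc \<Longrightarrow> g' (g z) = z"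
    using holomorphic_has_inverse[OF koenigs_functionD(1)[OF g] open_ball koenigs_functionD(2)[OF g]] by metis
  define f where "f z = g' (h z)" for z
  have gf: "f z \<in> unit_disc \<and> g (f z) = h z" if "z \<in> unit_disc" for z
    using sub that g'(2) by (force simp: f_def)
  have "g' \<circ> h holomorphic_on unit_disc"
    using holomorphic_on_compose_gen[OF koenigs_functionD(1)[OF h] g'(1) sub] .
  then have "f holomorphic_on unit_disc"
    by (simp add: f_def[abs_def] o_def)
  moreover have "f ` unit_disc \<subseteq> unit_disc"
    using gf by blast
  moreover have "inj_on f unit_disc"
    using gf koenigs_functionD(2)[OF h] by (metis inj_on_def)
  moreover have "f (\<phi> t z) = \<psi> t (f z)" if t: "t \<ge> 0" and z: "cmod z < 1" for t z
  proof -
    have 1: "cmod (f z) < 1" "cmod (f (\<phi> t z)) < 1" "cmod (\<phi> t z) < 1" "cmod (\<psi> t (f z)) < 1"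
      using gf[of z] gf[of "\<phi> t z"] disc_semigroupD(3)[OF \<phi> t z] disc_semigroupD(3)[OF \<psi> t] z by auto
    have "g (f (\<phi> t z)) = h z + \<i> * of_real t"
      using gf[of "\<phi> t z"] 1 koenigs_functionD(3)[OF h t z] by simp
    moreover have "g (\<psi> t (f z)) = h z + \<i> * of_real t"
      using gf[of z] z koenigs_functionD(3)[OF g t 1(1)] by simp
    ultimately show ?thesis
      using inj_onD[OF koenigs_functionD(2)[OF g], of "f (\<phi> t z)" "\<psi> t (f z)"] 1 by simp
  qed
  ultimately show ?thesis using that by blast
qed

text \<open>Under non-tangential convergence of \<open>\<phi> t 0\<close> the growth bound suffices. Otherwise the
  half-plane version \<open>F\<close> of \<open>f\<close> is subject to \<open>escaping_curve_bound\<close> along the orbit of \<open>\<phi>\<close>,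
  on which it takes values comparable to the orbit of \<open>\<psi>\<close>.\<close>

theorem orbit_comparison:
  assumes \<phi>: "disc_semigroup \<phi>" and \<psi>: "disc_semigroup \<psi>"
    and h: "koenigs_function \<phi> h" and g: "koenigs_function \<psi> g"
    and sub: "h ` unit_disc \<subseteq> g ` unit_disc"
    and alt: "nontangential_orbit \<phi> \<or> nontangential_orbit \<psi> \<or>
         eventually_nondecreasing (orthogonal_speed \<psi>) \<or>
         eventually_nondecreasing (total_speed \<psi>)"
  shows "\<exists>K. \<forall>\<^sub>F t in at_top. cmod (cayley (denjoy_wolff_point \<psi>) (\<psi> t 0))
       \<le> K * cmod (cayley (denjoy_wolff_point \<phi>) (\<phi> t 0))"
proof -
  define \<tau> where "\<tau> = denjoy_wolff_point \<phi>"
  define \<sigma> where "\<sigma> = denjoy_wolff_point \<psi>"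
  have \<tau>: "cmod \<tau> = 1" using denjoy_wolff(1)[OF \<phi> h] by (simp add: \<tau>_def)
  have \<sigma>: "cmod \<sigma> = 1" using denjoy_wolff(1)[OF \<psi> g] by (simp add: \<sigma>_def)
  obtain f where f: "f holomorphic_on unit_disc" "f ` unit_disc \<subseteq> unit_disc" "inj_on f unit_disc"
    and f\<phi>: "\<And>t z. t \<ge> 0 \<Longrightarrow> cmod z < 1 \<Longrightarrow> f (\<phi> t z) = \<psi> t (f z)"
    using koenigs_transfer[OF \<phi> \<psi> h g sub] by metis
  have fD: "cmod (f z) < 1" if "cmod z < 1" for z
    using subsetD[OF f(2) imageI[of z]] that by auto
  have zD: "cmod (\<phi> t 0) < 1" "cmod (\<psi> t 0) < 1" if "t \<ge> 0" for t
    using disc_semigroupD(3)[OF \<phi> that, of 0] disc_semigroupD(3)[OF \<psi> that, of 0] by auto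
  define w where "w t = cayley \<tau> (\<phi> t 0)" for t
  define v where "v t = cayley \<sigma> (\<psi> t 0)" for t
  define W where "W t = cayley \<sigma> (f (\<phi> t 0))" for t
  define q where "q = cmod (f 0)"
  have q: "0 \<le> q" "q < 1" using fD[of 0] by (simp_all add: q_def)
  \<comment> \<open>\<open>q\<close> bounds the pseudo-hyperbolic distance of \<open>f (\<phi> t 0) = \<psi> t (f 0)\<close> from \<open>\<psi> t 0\<close>, and \<open>Q\<close> is
    the resulting bound for the quotients of the moduli in the half-plane.\<close>
  define Q where "Q = (1 + q) / (1 - q)"
  have Q: "Q > 0" using q by (simp add: Q_def)
  have near: "pdist (f (\<phi> t 0)) (\<psi> t 0) \<le> q" "pdist (\<psi> t 0) (f (\<phi> t 0)) \<le> q" if "t \<ge> 0" for t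
    using schwarz_pick[OF disc_semigroupD(1,2)[OF \<psi> that], of "f 0" 0]
      schwarz_pick[OF disc_semigroupD(1,2)[OF \<psi> that], of 0 "f 0"] f\<phi>[OF that, of 0] fD[of 0]
    by (simp_all add: q_def pdist_def Moebius_function_simple)
  have WQ: "cmod (W t) \<le> Q * cmod (v t)" and vQ: "cmod (v t) \<le> Q * cmod (W t)" if "t \<ge> 0" for t
    using norm_cayley_le_of_pdist_le[OF \<sigma> _ _ near(1)[OF that]]
      norm_cayley_le_of_pdist_le[OF \<sigma> _ _ near(2)[OF that]] fD[of "\<phi> t 0"] zD[OF that] q
    by (simp_all add: Q_def v_def W_def pos_le_divide_eq mult.commute)
  obtain C where C: "C > 0"
    and growth: "\<And>z. cmod z < 1 \<Longrightarrow> cmod (cayley \<sigma> (f z)) \<le> C * ((cmod (cayley \<tau> z + 1))\<^sup>2 / Re (cayley \<tau> z))"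
    using cayley_growth[OF f(1,2) \<tau> \<sigma>] by metis
  have pos: "Re (w t) > 0" if "t \<ge> 0" for t
    using Re_cayley_pos[OF \<tau> zD(1)[OF that]] by (simp add: w_def)
  have w_lim: "filterlim (\<lambda>t. cmod (w t)) at_top at_top"
    using orbit_cayley_at_top[OF \<phi> h] by (simp add: w_def \<tau>_def)
  then have w1: "\<forall>\<^sub>F t in at_top. cmod (w t) \<ge> 1"
    by (simp add: filterlim_at_top)
  have "\<exists>K. \<forall>\<^sub>F t in at_top. cmod (v t) \<le> K * cmod (w t)"
  proof (cases "nontangential_orbit \<phi>")
    case True
    then obtain M where M: "\<forall>\<^sub>F t in at_top. cmod (\<tau> - \<phi> t 0) \<le> M * (1 - cmod (\<phi> t 0))"
      by (auto simp: nontangential_orbit_def Let_def \<tau>_def)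
    have "\<forall>\<^sub>F t in at_top. cmod (v t) \<le> (Q * (C * (4 * (2 * M)))) * cmod (w t)"
      using M w1 eventually_ge_at_top[of 0]
    proof eventually_elim
      case (elim t)
      have "cmod (w t) \<le> 2 * M * Re (w t)"
        using nontangential_norm_cayley_le[OF \<tau> zD(1) elim(1)] elim(3) by (simp add: w_def)
      then have "cmod (w t) * cmod (w t) \<le> cmod (w t) * (2 * M * Re (w t))"
        by (intro mult_left_mono) auto
      moreover have "(cmod (w t + 1))\<^sup>2 \<le> (2 * cmod (w t))\<^sup>2"
        using norm_triangle_ineq[of "w t" 1] elim(2) by (intro power_mono) auto
      ultimately have "(cmod (w t + 1))\<^sup>2 \<le> 4 * (2 * M) * cmod (w t) * Re (w t)"
        by (simp add: power2_eq_square algebra_simps)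
      then have "(cmod (w t + 1))\<^sup>2 / Re (w t) \<le> 4 * (2 * M) * cmod (w t)"
        using pos[OF elim(3)] by (simp add: pos_divide_le_eq)
      then have "C * ((cmod (w t + 1))\<^sup>2 / Re (w t)) \<le> C * (4 * (2 * M) * cmod (w t))"
        using C by (intro mult_left_mono) auto
      with growth[OF zD(1)[OF elim(3)]] have "cmod (W t) \<le> C * (4 * (2 * M) * cmod (w t))"
        by (simp add: W_def w_def)
      then have "Q * cmod (W t) \<le> Q * (C * (4 * (2 * M) * cmod (w t)))"
        using Q by (intro mult_left_mono) auto
      with vQ[OF elim(3)] show ?case by (simp add: mult.assoc)
    qed
    then show ?thesis by blast
  next
    case False
    with alt obtain c t0 where c: "c > 0" "t0 \<ge> 0"
      and mono: "\<And>t s. t \<ge> t0 \<Longrightarrow> s \<ge> t \<Longrightarrow> c * cmod (v t) \<le> cmod (v s)"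
      using orbit_cayley_almost_nondecreasing[OF \<psi> g] unfolding v_def \<sigma>_def by blast
    define F where "F u = cayley \<sigma> (f (cayley_inv \<tau> u))" for u
    have inv_D: "cmod (cayley_inv \<tau> u) < 1" if "Re u > 0" for u
      using cayley_inv_in_disc[OF \<tau> that] .
    have F_hol: "F holomorphic_on {u. Re u > 0}"
    proof -
      have "f \<circ> cayley_inv \<tau> holomorphic_on {u. Re u > 0}"
        by (rule holomorphic_on_compose_gen[OF cayley_inv_holomorphic f(1)]) (use inv_D in auto)
      then have "cayley \<sigma> \<circ> (f \<circ> cayley_inv \<tau>) holomorphic_on {u. Re u > 0}"
        by (rule holomorphic_on_compose_gen[OF _ cayley_holomorphic[OF \<sigma>]]) (use inv_D fD in auto)
      then show ?thesis by (simp add: F_def[abs_def] o_def)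
    qed
    have F_inj: "inj_on F {u. Re u > 0}"
    proof (rule inj_onI)
      fix u u' assume u: "u \<in> {u. Re u > 0}" "u' \<in> {u. Re u > 0}" and "F u = F u'"
      then have "f (cayley_inv \<tau> u) = f (cayley_inv \<tau> u')"
        unfolding F_def using cayley_inv_cayley[OF \<sigma>] fD inv_D by (metis mem_Collect_eq)
      then have "cayley_inv \<tau> u = cayley_inv \<tau> u'"
        using inj_onD[OF f(3)] inv_D u by auto
      then show "u = u'"
        using cayley_cayley_inv[OF \<tau>] u by (metis mem_Collect_eq)
    qed
    have F_pos: "Re (F u) > 0" if "Re u > 0" for u
      unfolding F_def by (rule Re_cayley_pos[OF \<sigma> fD[OF inv_D[OF that]]])
    have F_real: "cmod (F (of_real x)) \<le> (4 * C) * x" if "x \<ge> 1" for x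
    proof -
      have "cmod (F (of_real x)) \<le> C * ((cmod (of_real x + 1))\<^sup>2 / x)"
        using growth[OF inv_D[of "of_real x"]] cayley_cayley_inv[OF \<tau>, of "of_real x"] that
        by (simp add: F_def)
      also have "(cmod (of_real x + 1))\<^sup>2 / x = (x + 1)\<^sup>2 / x"
        using that norm_of_real[of "x + 1", where 'a = complex] by (simp del: norm_of_real)
      also have "\<dots> \<le> 4 * x"
      proof -
        have "(x + 1)\<^sup>2 \<le> (2 * x)\<^sup>2" using that by (intro power_mono) auto
        then show ?thesis using that by (simp add: pos_divide_le_eq power2_eq_square)
      qed
      finally show ?thesis using C by simp
    qed
    have Fw: "F (w t) = W t" if "t \<ge> 0" for t
      using cayley_inv_cayley[OF \<tau> zD(1)[OF that]] by (simp add: F_def w_def W_def)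
    have w_cont: "continuous_on {t..} w" if "t \<ge> 0" for t
    proof -
      have "continuous_on {t..} (\<lambda>t. \<phi> t 0)"
        by (rule continuous_on_subset[OF continuous_on_semigroup_orbit[OF \<phi>]]) (use that in auto)
      then show ?thesis
        unfolding w_def
        by (rule continuous_on_compose2[OF holomorphic_on_imp_continuous_on[OF cayley_holomorphic[OF \<tau>]]])
          (use zD(1) that in auto)
    qed
    define E where "E = 3 * (4 * C) * exp (36 * pi * disc_area)"
    have "\<forall>\<^sub>F t in at_top. cmod (v t) \<le> (Q / c * E) * cmod (w t)"
      using w1 eventually_ge_at_top[of t0]
    proof eventually_elim
      case (elim t)
      with c have t: "t \<ge> 0" by simp
      have v_pos: "cmod (v t) > 0"
        using Re_cayley_pos[OF \<sigma> zD(2)[OF t]] by (auto simp: v_def)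
      have "c / Q * cmod (v t) \<le> cmod (F (w s))" if "s \<ge> t" for s
      proof -
        have "c * cmod (v t) \<le> Q * cmod (W s)"
          using mono[OF elim(2) that] vQ[of s] t that by linarith
        then show ?thesis using Q Fw[of s] t that by (simp add: field_simps)
      qed
      then have "c / Q * cmod (v t) \<le> E * cmod (w t)"
        unfolding E_def using C c Q v_pos pos t elim(1)
        by (intro escaping_curve_bound[OF F_hol F_inj F_pos _ F_real w_cont[OF t] _ w_lim]) auto
      then show ?case using c Q by (simp add: field_simps)
    qed
    then show ?thesis by blast
  qed
  then show ?thesis by (simp add: v_def w_def \<tau>_def \<sigma>_def)
qed

theorem theorem6p2:
  fixes \<phi> \<psi> :: "real \<Rightarrow> complex \<Rightarrow> complex"
    and h g :: "complex \<Rightarrow> complex"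
  assumes "disc_semigroup \<phi>" and "non_elliptic \<phi>"
    and "disc_semigroup \<psi>" and "non_elliptic \<psi>"
    and "koenigs_function \<phi> h" and "koenigs_function \<psi> g"
    and "h ` unit_disc \<subseteq> g ` unit_disc"
    and "nontangential_orbit \<phi> \<or> nontangential_orbit \<psi> \<or>
         eventually_nondecreasing (orthogonal_speed \<psi>) \<or>
         eventually_nondecreasing (total_speed \<psi>)"
  shows "Liminf at_top (\<lambda>t. ereal (orthogonal_speed \<phi> t - orthogonal_speed \<psi> t)) > -\<infinity>"
proof -
  note \<phi> = assms(1) and \<psi> = assms(3) and h = assms(5) and g = assms(6)
  define w where "w t = cmod (cayley (denjoy_wolff_point \<phi>) (\<phi> t 0))" for t
  define v where "v t = cmod (cayley (denjoy_wolff_point \<psi>) (\<psi> t 0))" for t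
  obtain K where K: "\<forall>\<^sub>F t in at_top. v t \<le> K * w t"
    using orbit_comparison[OF \<phi> \<psi> h g assms(7,8)] unfolding w_def v_def by blast
  have w1: "\<forall>\<^sub>F t in at_top. w t \<ge> 1" and v1: "\<forall>\<^sub>F t in at_top. v t \<ge> 1"
    using orbit_cayley_at_top[OF \<phi> h] orbit_cayley_at_top[OF \<psi> g]
    by (simp_all add: filterlim_at_top w_def v_def)
  have "\<forall>\<^sub>F t in at_top. ereal (- (ln K / 2)) \<le> ereal (orthogonal_speed \<phi> t - orthogonal_speed \<psi> t)"
    using K w1 v1 eventually_ge_at_top[of 0]
  proof eventually_elim
    case (elim t)
    have "K * w t > 0" using elim by linarith
    then have "K > 0" using elim by (simp add: zero_less_mult_iff)
    have "ln (v t) \<le> ln (K * w t)" using elim by simp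
    also have "\<dots> = ln K + ln (w t)" using \<open>K > 0\<close> elim by (simp add: ln_mult)
    finally show ?case
      using orthogonal_speed_eq[OF \<phi> h elim(4)] orthogonal_speed_eq[OF \<psi> g elim(4)] elim
      by (simp add: w_def v_def)
  qed
  then have "ereal (- (ln K / 2)) \<le> Liminf at_top (\<lambda>t. ereal (orthogonal_speed \<phi> t - orthogonal_speed \<psi> t))"
    by (rule Liminf_bounded)
  then show ?thesis
    by (rule less_le_trans[rotated]) simp
qed

end
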